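(* Let $\mathcal{A}\in\mathbb{R}^{n_1\times\cdots\times n_d}$ with $d\ge 2$, let $p\in\{1,\dots,d\}$ and $\varepsilon\ge 0$. Let $\mathcal{G}^{(1)},\dots,\mathcal{G}^{(d)}$ be the cores output by the sparse TT conversion procedure (described below) on $(\mathcal{A},p)$, and let $\mathcal{B}$ be the TT tensor output by the static-tolerance TT-rounding procedure (described below) applied to these cores with parameters $\varepsilon$ and $p$. Then $\|\mathcal{A}-\mathcal{B}\|_F\le\varepsilon\|\mathcal{A}\|_F$.
   Context: TT format: cores $\mathcal{G}^{(k)}\in\mathbb{R}^{r_{k-1}\times n_k\times r_k}$, $r_0=r_d=1$, represent the tensor with entries $\mathcal{G}^{(1)}(:,i_1,:)\cdots\mathcal{G}^{(d)}(:,i_d,:)$. For a core $\mathcal{G}\in\mathbb{R}^{a\times n\times b}$: $\mathbf{L}(\mathcal{G})\in\mathbb{R}^{an\times b}$, $\mathbf{L}(\mathcal{G})_{(i-1)n+j,\,l}=\mathcal{G}(i,j,l)$; $\mathbf{R}(\mathcal{G})\in\mathbb{R}^{a\times nb}$, $\mathbf{R}(\mathcal{G})_{i,\,(j-1)b+l}=\mathcal{G}(i,j,l)$. A $p$-fiber of $\mathcal{A}$ is a vector $\mathcal{A}(i_1,\dots,i_{p-1},:,i_{p+1},\dots,i_d)\in\mathbb{R}^{n_p}$. $\operatorname{Depar}$: given $\mathbf{M}\in\mathbb{R}^{a\times b}$, process columns $j=1,\dots,b$ in order keeping an ordered list $K$ of kept columns: if $\mathbf{M}_{:,j}=cK_i$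 for some kept $K_i$ and scalar $c$ (first such $i$), set $T_{i,j}=c$; otherwise append $\mathbf{M}_{:,j}$ to $K$ and set $T_{|K|,j}=1$; other entries of $\mathbf{T}$ zero. Output $\mathbf{N}=[K_1\cdots K_\beta]$, $\mathbf{T}\in\mathbb{R}^{\beta\times b}$. Sparse TT conversion on $(\mathcal{A},p)$: enumerate nonzero $p$-fibers as $j=1,\dots,R$ with fixed indices $(i^{(j)}_1,\dots,i^{(j)}_{p-1},i^{(j)}_{p+1},\dots,i^{(j)}_d)$ and values $\mathbf{v}_j$. Initial TT with ranks $r_0=r_d=1$, $r_k=R$ otherwise: for $k\neq p$, $\mathcal{G}^{(k)}(a,i,b)=1$ if $i=i^{(j)}_k$, where $j=b$ if $k=1$, $j=a$ if $k=d$, and $a=b=j$ is required if $1<k<d$, else $0$; $\mathcal{G}^{(p)}(a,i,b)=\mathbf{v}_j(i)$ with $j$ by the same rule, else $0$. Then for $k=1,\dots,p-1$: $(\mathbf{N},\mathbf{T})=\operatorname{Depar}(\mathbf{L}(\mathcal{G}^{(k)}))$, replace $\mathcal{G}^{(k)}$ by the core with $\mathbf{L}$-unfolding $\mathbf{N}$, and each slice $\mathcal{G}^{(k+1)}(:,i,:)$ by $\mathbf{T}\mathcal{G}^{(k+1)}(:,i,:)$. Then for $k=d,\dots,p+1$: $(\mathbf{N},\mathbf{T})=\operatorname{Depar}(\mathbf{R}(\mathcal{G}^{(k)})^T)$, replace $\mathcal{G}^{(k)}$ by the core with $\mathbf{R}$-unfolding $\mathbf{N}^T$, and each slice $\mathcal{G}^{(k-1)}(:,i,:)$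 by $\mathcal{G}^{(k-1)}(:,i,:)\mathbf{T}^T$. The output cores represent $\mathcal{A}$ exactly. $\delta$-truncated SVD of a matrix $\mathbf{G}$ with SVD $\mathbf{G}=\sum_i\sigma_i\mathbf{u}_i\mathbf{v}_i^T$ ($\sigma_1\ge\sigma_2\ge\cdots$): take the smallest $r$ with $\sum_{i>r}\sigma_i^2\le\delta^2$, $\mathbf{U}=[\mathbf{u}_1\cdots\mathbf{u}_r]$, $\boldsymbol{\Sigma}=\mathrm{diag}(\sigma_1,\dots,\sigma_r)$, $\mathbf{V}=[\mathbf{v}_1\cdots\mathbf{v}_r]$, error $\mathbf{E}=\mathbf{G}-\mathbf{U}\boldsymbol{\Sigma}\mathbf{V}^T$ (so $\|\mathbf{E}\|_F\le\delta$). Static-tolerance TT-rounding with $(\varepsilon,p)$: set $\delta_k=\frac{\varepsilon}{\sqrt{p-1}+\sqrt{d-p}}\|\mathcal{A}\|_F$ for all $k$. (First SVD-sweep) for $k=p,\dots,d-1$: compute the $\delta_k$-truncated SVD $\mathbf{L}(\mathcal{G}^{(k)})=\mathbf{U}\boldsymbol{\Sigma}\mathbf{V}^T+\mathbf{E}_k$, set $r_k$ to the number of columns of $\mathbf{U}$, replace $\mathcal{G}^{(k)}$ by the core with $\mathbf{L}$-unfolding $\mathbf{U}$, and each slice $\mathcal{G}^{(k+1)}(:,i,:)$ by $\boldsymbol{\Sigma}\mathbf{V}^T\mathcal{G}^{(k+1)}(:,i,:)$. (QR-sweep) for $k=d,\dots,p+1$: compute an economic QR decomposition $\mathbf{R}(\mathcal{G}^{(k)})^T=\mathbf{Q}\mathbf{R}$,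 replace $\mathcal{G}^{(k)}$ by the core with $\mathbf{R}$-unfolding $\mathbf{Q}^T$ and each slice $\mathcal{G}^{(k-1)}(:,i,:)$ by $\mathcal{G}^{(k-1)}(:,i,:)\mathbf{R}^T$. (Second SVD-sweep) for $k=p,\dots,2$: compute the $\delta_{k-1}$-truncated SVD $\mathbf{R}(\mathcal{G}^{(k)})^T=\mathbf{U}\boldsymbol{\Sigma}\mathbf{V}^T+\mathbf{E}_{k-1}$, replace $\mathcal{G}^{(k)}$ by the core with $\mathbf{R}$-unfolding $\mathbf{U}^T$ and each slice $\mathcal{G}^{(k-1)}(:,i,:)$ by $\mathcal{G}^{(k-1)}(:,i,:)\mathbf{V}\boldsymbol{\Sigma}$. Return the resulting cores as the TT $\mathcal{B}$. *)

theory Defs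
  imports "Jordan_Normal_Form.Matrix"
begin

(* Conventions: all matrix/core indices are 0-based internally; mode indices
   k and the parameter p are 1-based as in the paper. *)

(* A tensor of size ns!0 x ... x ns!(d-1) is a function on index lists;
   only values on valid index lists matter. *)
definition idxs :: "nat list \<Rightarrow> nat list set" where
  "idxs ns = {is. length is = length ns \<and> (\<forall>k<length ns. is!k < ns!k)}"

definition fro_norm :: "nat list \<Rightarrow> (nat list \<Rightarrow> real) \<Rightarrow> real" where
  "fro_norm ns A = sqrt (\<Sum>is\<in>idxs ns. (A is)^2)"

(* Core (a, n, b, G) with G a i b, 0 \<le> a < r_{k-1}, 0 \<le> i < n, 0 \<le> b < r_k *)
datatype core = Core (crow: nat) (cmid: nat) (ccol: nat) (cent: "nat \<Rightarrow> nat \<Rightarrow> nat \<Rightarrow> real")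

definition slice :: "core \<Rightarrow> nat \<Rightarrow> real mat" where
  "slice C i = mat (crow C) (ccol C) (\<lambda>(a,b). cent C a i b)"

(* L-unfolding: row a*n+i, column b  (0-based version of (i-1)n+j) *)
definition Lunf :: "core \<Rightarrow> real mat" where
  "Lunf C = mat (crow C * cmid C) (ccol C) (\<lambda>(r,l). cent C (r div cmid C) (r mod cmid C) l)"

definition Runf :: "core \<Rightarrow> real mat" where
  "Runf C = mat (crow C) (cmid C * ccol C) (\<lambda>(a,c). cent C a (c div ccol C) (c mod ccol C))"

definition of_Lunf :: "nat \<Rightarrow> real mat \<Rightarrow> core" where
  "of_Lunf n M = Core (dim_row M div n) n (dim_col M) (\<lambda>a i l. M $$ (a*n+i, l))"

definition of_Runf :: "nat \<Rightarrow> real mat \<Rightarrow> core" where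
  "of_Runf n M = Core (dim_row M) n (dim_col M div n) (\<lambda>a i l. M $$ (a, i*(dim_col M div n)+l))"

definition map_slices :: "nat \<Rightarrow> nat \<Rightarrow> (real mat \<Rightarrow> real mat) \<Rightarrow> core \<Rightarrow> core" where
  "map_slices r' c' f C = Core r' (cmid C) c' (\<lambda>a i b. f (slice C i) $$ (a,b))"

definition tt_entry :: "core list \<Rightarrow> nat list \<Rightarrow> real" where
  "tt_entry Gs is = (foldl (\<lambda>M (G,i). M * slice G i) (1\<^sub>m 1) (zip Gs is)) $$ (0,0)"

definition depar_step :: "real vec list \<times> (nat \<times> real) list \<Rightarrow> real vec \<Rightarrow> real vec list \<times> (nat \<times> real) list" where
  "depar_step st v = (case st of (K, tc) \<Rightarrow>
     if \<exists>i<length K. \<exists>c. v = c \<cdot>\<^sub>v (K!i) then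
       (let i = (LEAST i. i < length K \<and> (\<exists>c. v = c \<cdot>\<^sub>v (K!i)));
            c = (SOME c. v = c \<cdot>\<^sub>v (K!i))
        in (K, tc @ [(i, c)]))
     else (K @ [v], tc @ [(length K, 1)]))"

definition depar :: "real mat \<Rightarrow> real mat \<times> real mat" where
  "depar M = (case foldl depar_step ([], []) (cols M) of (K, tc) \<Rightarrow>
     (mat (dim_row M) (length K) (\<lambda>(r,i). (K!i) $ r),
      mat (length K) (dim_col M) (\<lambda>(i,j). if fst (tc!j) = i then snd (tc!j) else 0)))"

(* p-fibers are identified by index lists js with js!(p-1) = 0 (placeholder);
   the fiber is i \<mapsto> A (js[p-1 := i]). *)
definition nonzero_fibers :: "nat list \<Rightarrow> (nat list \<Rightarrow> real) \<Rightarrow> nat \<Rightarrow> nat list set" where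
  "nonzero_fibers ns A p =
     {js. length js = length ns \<and> (\<forall>k<length ns. k \<noteq> p - 1 \<longrightarrow> js!k < ns!k) \<and> js!(p-1) = 0 \<and>
          (\<exists>i<ns!(p-1). A (js[p-1 := i]) \<noteq> 0)}"

(* initial core k (1-based), fs = enumeration of the nonzero fibers *)
definition init_core :: "nat list \<Rightarrow> (nat list \<Rightarrow> real) \<Rightarrow> nat \<Rightarrow> nat list list \<Rightarrow> nat \<Rightarrow> core" where
  "init_core ns A p fs k =
    (let d = length ns; R = length fs;
         rl = (if k = 1 then 1 else R); rr = (if k = d then 1 else R)
     in Core rl (ns!(k-1)) rr (\<lambda>a i b.
          let ok = (if k = 1 \<or> k = d then True else a = b);
              j = (if k = 1 then b else a)
          in if ok then (if k = p then A ((fs!j)[p-1 := i])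
                         else (if i = fs!j!(k-1) then 1 else 0))
             else 0))"

definition conv_left_step :: "nat list \<Rightarrow> nat \<Rightarrow> core list \<Rightarrow> core list" where
  "conv_left_step ns k Gs =
     (case depar (Lunf (Gs!(k-1))) of (N, T) \<Rightarrow>
        Gs[k-1 := of_Lunf (ns!(k-1)) N,
           k := map_slices (dim_row T) (ccol (Gs!k)) (\<lambda>X. T * X) (Gs!k)])"

definition conv_right_step :: "nat list \<Rightarrow> nat \<Rightarrow> core list \<Rightarrow> core list" where
  "conv_right_step ns k Gs =
     (case depar (transpose_mat (Runf (Gs!(k-1)))) of (N, T) \<Rightarrow>
        Gs[k-1 := of_Runf (ns!(k-1)) (transpose_mat N),
           k-2 := map_slices (crow (Gs!(k-2))) (dim_row T) (\<lambda>X. X * transpose_mat T) (Gs!(k-2))])"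

definition sparse_tt :: "nat list \<Rightarrow> (nat list \<Rightarrow> real) \<Rightarrow> nat \<Rightarrow> nat list list \<Rightarrow> core list" where
  "sparse_tt ns A p fs =
     (let d = length ns;
          G0 = map (init_core ns A p fs) [1..<d+1];
          G1 = foldl (\<lambda>Gs k. conv_left_step ns k Gs) G0 [1..<p]
      in foldl (\<lambda>Gs k. conv_right_step ns k Gs) G1 (rev [p+1..<d+1]))"

definition is_trunc_svd :: "real \<Rightarrow> real mat \<Rightarrow> real mat \<Rightarrow> real mat \<Rightarrow> real mat \<Rightarrow> bool" where
  "is_trunc_svd \<delta> G U S V \<longleftrightarrow>
    (let m = dim_row G; n = dim_col G; q = min m n in
     \<exists>\<sigma> u v r.
       (\<forall>i<q. u i \<in> carrier_vec m \<and> v i \<in> carrier_vec n) \<and>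
       (\<forall>i<q. \<forall>j<q. u i \<bullet> u j = (if i = j then 1 else 0) \<and> v i \<bullet> v j = (if i = j then 1 else 0)) \<and>
       (\<forall>i<q. 0 \<le> \<sigma> i) \<and> (\<forall>i j. i \<le> j \<longrightarrow> j < q \<longrightarrow> \<sigma> j \<le> \<sigma> i) \<and>
       (\<forall>a<m. \<forall>b<n. G $$ (a,b) = (\<Sum>i<q. \<sigma> i * (u i $ a) * (v i $ b))) \<and>
       r = (LEAST r. (\<Sum>i\<in>{r..<q}. (\<sigma> i)^2) \<le> \<delta>^2) \<and>
       U = mat m r (\<lambda>(a,i). u i $ a) \<and>
       S = mat r r (\<lambda>(i,j). if i = j then \<sigma> i else 0) \<and>
       V = mat n r (\<lambda>(b,i). v i $ b))"

definition is_econ_qr :: "real mat \<Rightarrow> real mat \<Rightarrow> real mat \<Rightarrow> bool" where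
  "is_econ_qr M Q R \<longleftrightarrow>
    (let m = dim_row M; n = dim_col M; k = min m n in
      Q \<in> carrier_mat m k \<and> R \<in> carrier_mat k n \<and>
      transpose_mat Q * Q = 1\<^sub>m k \<and>
      (\<forall>i<k. \<forall>j<n. j < i \<longrightarrow> R $$ (i,j) = 0) \<and>
      M = Q * R)"

section \<open>Static-tolerance TT-rounding (relational: all admissible SVD/QR choices)\<close>

definition svd1_step :: "real \<Rightarrow> nat \<Rightarrow> core list \<Rightarrow> core list \<Rightarrow> bool" where
  "svd1_step \<delta> k Gs Gs' \<longleftrightarrow> (\<exists>U S V.
     is_trunc_svd \<delta> (Lunf (Gs!(k-1))) U S V \<and>
     Gs' = Gs[k-1 := of_Lunf (cmid (Gs!(k-1))) U,
              k := map_slices (dim_row S) (ccol (Gs!k)) (\<lambda>X. S * transpose_mat V * X) (Gs!k)])"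

definition qr_step :: "nat \<Rightarrow> core list \<Rightarrow> core list \<Rightarrow> bool" where
  "qr_step k Gs Gs' \<longleftrightarrow> (\<exists>Q R.
     is_econ_qr (transpose_mat (Runf (Gs!(k-1)))) Q R \<and>
     Gs' = Gs[k-1 := of_Runf (cmid (Gs!(k-1))) (transpose_mat Q),
              k-2 := map_slices (crow (Gs!(k-2))) (dim_row R) (\<lambda>X. X * transpose_mat R) (Gs!(k-2))])"

definition svd2_step :: "real \<Rightarrow> nat \<Rightarrow> core list \<Rightarrow> core list \<Rightarrow> bool" where
  "svd2_step \<delta> k Gs Gs' \<longleftrightarrow> (\<exists>U S V.
     is_trunc_svd \<delta> (transpose_mat (Runf (Gs!(k-1)))) U S V \<and>
     Gs' = Gs[k-1 := of_Runf (cmid (Gs!(k-1))) (transpose_mat U),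
              k-2 := map_slices (crow (Gs!(k-2))) (dim_col S) (\<lambda>X. X * V * S) (Gs!(k-2))])"

fun chain :: "(nat \<Rightarrow> 'a \<Rightarrow> 'a \<Rightarrow> bool) \<Rightarrow> nat list \<Rightarrow> 'a \<Rightarrow> 'a \<Rightarrow> bool" where
  "chain R [] x y \<longleftrightarrow> x = y"
| "chain R (k # ks) x y \<longleftrightarrow> (\<exists>z. R k x z \<and> chain R ks z y)"

(* Bs is a possible output of static-tolerance TT-rounding of Gs with (eps, p),
   where nrmA = ||A||_F *)
definition tt_round :: "real \<Rightarrow> nat \<Rightarrow> real \<Rightarrow> core list \<Rightarrow> core list \<Rightarrow> bool" where
  "tt_round \<epsilon> p nrmA Gs Bs \<longleftrightarrow>
    (let d = length Gs;
         \<delta> = \<epsilon> / (sqrt (real (p - 1)) + sqrt (real (d - p))) * nrmA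
     in \<exists>G1 G2. chain (svd1_step \<delta>) [p..<d] Gs G1 \<and>
                chain qr_step (rev [p+1..<d+1]) G1 G2 \<and>
                chain (svd2_step \<delta>) (rev [2..<p+1]) G2 Bs)"

end

(*
  Write each truncated factorization of a core as G = G' T + E with G' orthonormal and G'^T E = 0.
  While the cores to the left of the active one are left-orthonormal and those to its right are
  right-orthonormal, one truncation changes the tensor by exactly |E| <= delta, and the errors of one
  sweep are mutually orthogonal; a sweep of m truncations therefore costs at most sqrt(m) delta by
  Pythagoras. The sparse conversion supplies the orthonormality needed by the first sweep: all its
  cores except the p-th have distinct unit vectors as columns of their unfoldings, a property that
  Depar preserves. The QR sweep changes nothing and prepares the second SVD sweep. Right-to-left
  sweeps are left-to-right sweeps on the transposed train, and the two sweeps are combined by the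
  triangle inequality.
*)
theory Submission
  imports Defs "HOL-Analysis.L2_Norm"
begin

text \<open>Depar, QR and truncated SVD all split a matrix into an orthonormal factor times a
  remainder factor \<open>T\<close>, plus a residual orthogonal to the former that is zero for the
  first two; one relation \<open>left_step\<close> therefore describes every update. The obstacle is
  that Depar removes parallel columns and in general gives no orthonormality. It does so here
  because the unfoldings it meets have unit vectors as columns, for which parallel means equal. This
  must survive the absorption of \<open>T\<close> into the next core, and it does since the columns
  of \<open>T\<close> are unit vectors too; columns may coincide afterwards, and the next Depar
  removes the repetitions. A core that absorbs \<open>T\<close> in a rounding sweep may lose its
  right-orthonormality, but it is then the active core, on which nothing is imposed. Orthogonality
  of errors is used only inside a sweep, with d - p and p - 1 truncations respectively; hence the
  sum of two square roots in the tolerance.\<close>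

section \<open>Sums over index lists\<close>

text \<open>The Frobenius inner product of the matrix products \<open>f g\<close> and
  \<open>f' g'\<close> depends only on the Gram matrices of the factors. Orthonormal factors thus
  preserve norms, and a vanishing Gram matrix kills a cross term.\<close>

lemma sum_bilinear:
  fixes f f' :: "'x \<Rightarrow> 'b \<Rightarrow> real" and g g' :: "'b \<Rightarrow> 'y \<Rightarrow> real"
  shows "(\<Sum>x\<in>X. \<Sum>y\<in>Y. (\<Sum>b\<in>B. f x b * g b y) * (\<Sum>c\<in>C. f' x c * g' c y)) =
    (\<Sum>b\<in>B. \<Sum>c\<in>C. (\<Sum>x\<in>X. f x b * f' x c) * (\<Sum>y\<in>Y. g b y * g' c y))"
proof -
  have "(\<Sum>x\<in>X. \<Sum>y\<in>Y. (\<Sum>b\<in>B. f x b * g b y) * (\<Sum>c\<in>C. f' x c * g' c y)) =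
     (\<Sum>x\<in>X. \<Sum>y\<in>Y. \<Sum>b\<in>B. \<Sum>c\<in>C. (f x b * f' x c) * (g b y * g' c y))"
    by (simp add: sum_product mult_ac)
  also have "\<dots> = (\<Sum>x\<in>X. \<Sum>b\<in>B. \<Sum>c\<in>C. \<Sum>y\<in>Y. (f x b * f' x c) * (g b y * g' c y))"
    by (subst sum.swap[of _ B Y], subst sum.swap[of _ C Y], rule refl)
  also have "\<dots> = (\<Sum>b\<in>B. \<Sum>c\<in>C. \<Sum>x\<in>X. \<Sum>y\<in>Y. (f x b * f' x c) * (g b y * g' c y))"
    by (subst sum.swap[of _ B X], subst sum.swap[of _ C X], rule refl)
  finally show ?thesis
    by (simp add: sum_product)
qed

lemma sum_power2_add:
  fixes u v :: "'x \<Rightarrow> 'y \<Rightarrow> real"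
  shows "(\<Sum>x\<in>X. \<Sum>y\<in>Y. (u x y + v x y)\<^sup>2) = (\<Sum>x\<in>X. \<Sum>y\<in>Y. (u x y)\<^sup>2) +
    (\<Sum>x\<in>X. \<Sum>y\<in>Y. (v x y)\<^sup>2) + 2 * (\<Sum>x\<in>X. \<Sum>y\<in>Y. u x y * v x y)"
  by (simp add: power2_sum sum.distrib sum_distrib_left mult.assoc)

lemma idxs_Nil [simp]: "idxs [] = {[]}"
  by (auto simp: idxs_def)

lemma idxs_Cons: "idxs (n # ns) = (\<lambda>(i, is). i # is) ` ({..<n} \<times> idxs ns)"
proof (intro equalityI subsetI)
  fix js assume "js \<in> idxs (n # ns)"
  then have js: "length js = Suc (length ns)" "\<forall>k<Suc (length ns). js ! k < (n # ns) ! k"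
    by (auto simp: idxs_def)
  then obtain i "is" where [simp]: "js = i # is"
    by (cases js) auto
  have "i < n" "length is = length ns" "\<forall>k<length ns. is ! k < ns ! k"
    using js by (auto dest: spec[of _ 0] spec[of _ "Suc _"])
  then show "js \<in> (\<lambda>(i, is). i # is) ` ({..<n} \<times> idxs ns)"
    by (auto simp: idxs_def)
qed (auto simp: idxs_def nth_Cons split: nat.splits)

lemma Cons_in_idxs_Cons [simp]: "i # is \<in> idxs (n # ns) \<longleftrightarrow> i < n \<and> is \<in> idxs ns"
  by (auto simp: idxs_Cons)

lemma sum_idxs_Cons:
  "(\<Sum>is\<in>idxs (n # ns). f is) = (\<Sum>i<n. \<Sum>is\<in>idxs ns. f (i # is))"
  unfolding idxs_Cons
  by (subst sum.reindex) (auto simp: inj_on_def sum.cartesian_product case_prod_unfold)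

lemma sum_lessThan_times:
  fixes r n :: nat
  shows "(\<Sum>x\<in>{..<r} \<times> {..<n}. f x) = (\<Sum>a<r. \<Sum>i<n. f (a, i))"
  by (simp add: sum.cartesian_product)

lemma rev_in_idxs_rev: "is \<in> idxs ns \<Longrightarrow> rev is \<in> idxs (rev ns)"
  by (auto simp: idxs_def rev_nth)

lemma idxs_rev: "idxs (rev ns) = rev ` idxs ns"
  using rev_in_idxs_rev[of _ ns] rev_in_idxs_rev[of _ "rev ns"]
  by (auto intro!: image_eqI[of _ rev "rev _"])

lemma sum_idxs_rev: "(\<Sum>is\<in>idxs (rev ns). f is) = (\<Sum>is\<in>idxs ns. f (rev is))"
  unfolding idxs_rev by (subst sum.reindex) (auto simp: inj_on_def)

section \<open>Tensor trains as functions\<close>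

text \<open>The product of slices with both boundary indices open, so that a train can be cut
  anywhere. Scalar sums avoid the carrier conditions of matrix products. The catch-all clause is the
  identity matrix, the value of the empty product.\<close>

fun tt_mat :: "core list \<Rightarrow> nat list \<Rightarrow> nat \<Rightarrow> nat \<Rightarrow> real" where
  "tt_mat (G # Gs) (i # is) a b = (\<Sum>c<ccol G. cent G a i c * tt_mat Gs is c b)"
| "tt_mat _ _ a b = of_bool (a = b)"

text \<open>General boundary ranks \<open>r\<close> and \<open>s\<close>, because inductions remove
  cores from the left end of a train whose outer ranks are 1.\<close>

fun tt_wf :: "nat \<Rightarrow> nat list \<Rightarrow> core list \<Rightarrow> nat \<Rightarrow> bool" where
  "tt_wf r [] [] s \<longleftrightarrow> r = s"
| "tt_wf r (n # ns) (G # Gs) s \<longleftrightarrow> crow G = r \<and> cmid G = n \<and> tt_wf (ccol G) ns Gs s"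
| "tt_wf _ _ _ _ \<longleftrightarrow> False"

lemma tt_wf_ConsE:
  assumes "tt_wf r ns (G # Gs) s"
  obtains ms where "ns = cmid G # ms" "crow G = r" "tt_wf (ccol G) ms Gs s"
  using assms by (cases ns) auto

lemma tt_wf_length: "tt_wf r ns Gs s \<Longrightarrow> length Gs = length ns"
  by (induction r ns Gs s rule: tt_wf.induct) auto

lemma tt_wf_append:
  "length ns = length Gs \<Longrightarrow>
    tt_wf r (ns @ ms) (Gs @ Hs) s \<longleftrightarrow> (\<exists>t. tt_wf r ns Gs t \<and> tt_wf t ms Hs s)"
  by (induction ns Gs arbitrary: r rule: list_induct2) auto

lemma tt_wf_cmid: "tt_wf r ns Gs s \<Longrightarrow> k < length ns \<Longrightarrow> cmid (Gs ! k) = ns ! k"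
  by (induction r ns Gs s arbitrary: k rule: tt_wf.induct) (auto simp: nth_Cons split: nat.splits)

lemma tt_wf_link: "tt_wf r ns Gs s \<Longrightarrow> Suc k < length ns \<Longrightarrow> ccol (Gs ! k) = crow (Gs ! Suc k)"
proof (induction r ns Gs s arbitrary: k rule: tt_wf.induct)
  case (2 r n ns G Gs s)
  then show ?case
    by (cases k; cases ns; cases Gs) auto
qed auto

lemma sum_of_bool_left [simp]:
  fixes f :: "nat \<Rightarrow> real"
  shows "(\<Sum>c<r. of_bool (a = c) * f c) = (if a < r then f a else 0)"
  by (simp add: of_bool_def if_distrib[of "\<lambda>x. x * _"] cong: if_cong)

lemma sum_of_bool_right [simp]:
  fixes f :: "nat \<Rightarrow> real"
  shows "(\<Sum>c<r. f c * of_bool (c = a)) = (if a < r then f a else 0)"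
  by (simp add: of_bool_def if_distrib[of "\<lambda>x. _ * x"] cong: if_cong)

text \<open>The bound on \<open>a\<close> serves the empty train, where the identity must find
  \<open>c = a\<close> inside the range of the sum.\<close>

lemma tt_mat_append:
  assumes "tt_wf r ns Gs t" "length is = length ns" "a < r"
  shows "tt_mat (Gs @ Hs) (is @ js) a b = (\<Sum>c<t. tt_mat Gs is a c * tt_mat Hs js c b)"
  using assms
proof (induction r ns Gs t arbitrary: "is" a rule: tt_wf.induct)
  case (2 r n ns G Gs s)
  then obtain i is' where [simp]: "is = i # is'" "length is' = length ns"
    by (cases "is") auto
  have "tt_mat ((G # Gs) @ Hs) (is @ js) a b =
      (\<Sum>c<ccol G. \<Sum>c'<s. cent G a i c * tt_mat Gs is' c c' * tt_mat Hs js c' b)"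
    using 2 by (simp add: sum_distrib_left mult_ac)
  also have "\<dots> = (\<Sum>c'<s. \<Sum>c<ccol G. cent G a i c * tt_mat Gs is' c c' * tt_mat Hs js c' b)"
    by (rule sum.swap)
  finally show ?case
    by (simp add: sum_distrib_right)
qed auto

text \<open>A left fold keeps the product so far in its accumulator, so the induction has to run
  over an arbitrary \<open>M\<close>; the identity is the case of interest.\<close>

lemma foldl_slice_tt_mat:
  assumes "tt_wf r ns Gs s" "length is = length ns" "M \<in> carrier_mat m r" "a < m" "b < s"
  shows "foldl (\<lambda>M (G, i). M * slice G i) M (zip Gs is) $$ (a, b) =
      (\<Sum>c<r. M $$ (a, c) * tt_mat Gs is c b)"
  using assms
proof (induction r ns Gs s arbitrary: "is" M rule: tt_wf.induct)
  case (2 r n ns G Gs s)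
  then obtain i is' where [simp]: "is = i # is'" "length is' = length ns"
    by (cases "is") auto
  have M': "M * slice G i \<in> carrier_mat m (ccol G)"
    using 2 by (auto simp: slice_def)
  have ent: "(M * slice G i) $$ (a, c) = (\<Sum>x<r. M $$ (a, x) * cent G x i c)" if "c < ccol G" for c
    using 2 that by (auto simp: slice_def scalar_prod_def lessThan_atLeast0)
  have "foldl (\<lambda>M (G, i). M * slice G i) M (zip (G # Gs) is) $$ (a, b) =
      (\<Sum>c<ccol G. (M * slice G i) $$ (a, c) * tt_mat Gs is' c b)"
    using 2 M' by simp
  also have "\<dots> = (\<Sum>c<ccol G. \<Sum>x<r. M $$ (a, x) * cent G x i c * tt_mat Gs is' c b)"
    by (simp add: ent sum_distrib_right)
  also have "\<dots> = (\<Sum>x<r. \<Sum>c<ccol G. M $$ (a, x) * cent G x i c * tt_mat Gs is' c b)"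
    by (rule sum.swap)
  finally show ?case
    by (simp add: sum_distrib_left mult.assoc)
qed auto

lemma tt_entry_eq_tt_mat:
  assumes "tt_wf 1 ns Gs 1" "length is = length ns"
  shows "tt_entry Gs is = tt_mat Gs is 0 0"
  unfolding tt_entry_def using foldl_slice_tt_mat[OF assms, of "1\<^sub>m 1" 1 0 0] by simp

section \<open>Transposition of cores and reversal of trains\<close>

definition core_transpose :: "core \<Rightarrow> core" where
  "core_transpose G = Core (ccol G) (cmid G) (crow G) (\<lambda>a i b. cent G b i a)"

definition tt_transpose :: "core list \<Rightarrow> core list" where
  "tt_transpose Gs = rev (map core_transpose Gs)"

lemma core_transpose_simps [simp]:
  "crow (core_transpose G) = ccol G" "cmid (core_transpose G) = cmid G"
  "ccol (core_transpose G) = crow G" "cent (core_transpose G) a i b = cent G b i a"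
  by (simp_all add: core_transpose_def)

lemma core_transpose_transpose [simp]: "core_transpose (core_transpose G) = G"
  by (cases G) (simp add: core_transpose_def)

lemma tt_transpose_transpose [simp]: "tt_transpose (tt_transpose Gs) = Gs"
  by (simp add: tt_transpose_def rev_map comp_def)

lemma length_tt_transpose [simp]: "length (tt_transpose Gs) = length Gs"
  by (simp add: tt_transpose_def)

lemma tt_transpose_Cons: "tt_transpose (G # Gs) = tt_transpose Gs @ [core_transpose G]"
  by (simp add: tt_transpose_def)

lemma nth_tt_transpose:
  "k < length Gs \<Longrightarrow> tt_transpose Gs ! k = core_transpose (Gs ! (length Gs - Suc k))"
  by (simp add: tt_transpose_def rev_nth)

lemma tt_wf_tt_transpose: "tt_wf r ns Gs s \<Longrightarrow> tt_wf s (rev ns) (tt_transpose Gs) r"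
proof (induction r ns Gs s rule: tt_wf.induct)
  case (2 r n ns G Gs s)
  then show ?case
    by (auto simp: tt_transpose_Cons tt_wf_append tt_wf_length)
qed (auto simp: tt_transpose_def)

lemma tt_mat_tt_transpose:
  assumes "tt_wf r ns Gs s" "length is = length ns" "a < r" "b < s"
  shows "tt_mat (tt_transpose Gs) (rev is) b a = tt_mat Gs is a b"
  using assms
proof (induction r ns Gs s arbitrary: "is" a rule: tt_wf.induct)
  case (2 r n ns G Gs s)
  then obtain i is' where [simp]: "is = i # is'" "length is' = length ns"
    by (cases "is") auto
  have "tt_mat (tt_transpose (G # Gs)) (rev is) b a =
     (\<Sum>c<ccol G. tt_mat (tt_transpose Gs) (rev is') b c * tt_mat [core_transpose G] [i] c a)"
    using 2 tt_mat_append[OF tt_wf_tt_transpose[of "ccol G" ns Gs s]] by (simp add: tt_transpose_Cons)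
  also have "\<dots> = (\<Sum>c<ccol G. tt_mat Gs is' c b * cent G a i c)"
    using 2 by simp
  finally show ?case
    by (simp add: mult.commute)
qed (auto simp: tt_transpose_def)

section \<open>Orthogonal factorizations and sweeps\<close>

text \<open>Rows are indexed by an arbitrary set: numbers for an unfolding, pairs (rank index, mode
  index) for a core.\<close>

definition orthonormal_cols :: "'x set \<Rightarrow> nat \<Rightarrow> ('x \<Rightarrow> nat \<Rightarrow> real) \<Rightarrow> bool" where
  "orthonormal_cols X r g \<longleftrightarrow>
     (\<forall>c<r. \<forall>c'<r. (\<Sum>x\<in>X. g x c * g x c') = of_bool (c = c'))"

definition residual :: "nat \<Rightarrow> ('x \<Rightarrow> nat \<Rightarrow> real) \<Rightarrow> ('x \<Rightarrow> nat \<Rightarrow> real) \<Rightarrow> (nat \<Rightarrow> nat \<Rightarrow> real)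
    \<Rightarrow> 'x \<Rightarrow> nat \<Rightarrow> real" where
  "residual r f g T x l = f x l - (\<Sum>c<r. g x c * T c l)"

text \<open>The common content of Depar, QR and truncated SVD; \<open>\<delta> = 0\<close> means an
  exact factorization.\<close>

definition ortho_factor :: "real \<Rightarrow> 'x set \<Rightarrow> nat \<Rightarrow> ('x \<Rightarrow> nat \<Rightarrow> real) \<Rightarrow> nat \<Rightarrow> ('x \<Rightarrow> nat \<Rightarrow> real)
    \<Rightarrow> (nat \<Rightarrow> nat \<Rightarrow> real) \<Rightarrow> bool" where
  "ortho_factor \<delta> X s f r g T \<longleftrightarrow> orthonormal_cols X r g \<and>
     (\<forall>l<s. \<forall>c<r. (\<Sum>x\<in>X. residual r f g T x l * g x c) = 0) \<and>
     (\<Sum>x\<in>X. \<Sum>l<s. (residual r f g T x l)\<^sup>2) \<le> \<delta>\<^sup>2"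

lemma ortho_factor_exact:
  assumes "ortho_factor 0 X s f r g T" "finite X" "x \<in> X" "l < s"
  shows "f x l = (\<Sum>c<r. g x c * T c l)"
proof -
  have "(\<Sum>x\<in>X. \<Sum>l<s. (residual r f g T x l)\<^sup>2) = 0"
    using assms(1) by (intro antisym) (auto simp: ortho_factor_def intro!: sum_nonneg)
  then have "(\<Sum>l<s. (residual r f g T x l)\<^sup>2) = 0"
    using assms by (subst (asm) sum_nonneg_eq_0_iff) (auto intro!: sum_nonneg)
  then show ?thesis
    using assms by (subst (asm) sum_nonneg_eq_0_iff) (auto simp: residual_def)
qed

text \<open>An unfolding merely renumbers the rows of a core, and all three conditions are sums over
  rows.\<close>

lemma ortho_factor_reindex:
  assumes "bij_betw h Y X" "ortho_factor \<delta> X s f r g T"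
    and "\<And>y l. y \<in> Y \<Longrightarrow> l < s \<Longrightarrow> f' y l = f (h y) l"
    and "\<And>y c. y \<in> Y \<Longrightarrow> c < r \<Longrightarrow> g' y c = g (h y) c"
  shows "ortho_factor \<delta> Y s f' r g' T"
proof -
  have [simp]: "residual r f' g' T y l = residual r f g T (h y) l" if "y \<in> Y" "l < s" for y l
    using assms that by (simp add: residual_def)
  have tr: "(\<Sum>y\<in>Y. F (h y)) = (\<Sum>x\<in>X. F x)" for F :: "_ \<Rightarrow> real"
    by (rule sum.reindex_bij_betw[OF assms(1)])
  have "(\<Sum>y\<in>Y. g' y c * g' y c') = (\<Sum>x\<in>X. g x c * g x c')" if "c < r" "c' < r" for c c'
    by (subst tr[symmetric]) (simp add: assms(4) that)
  moreover have "(\<Sum>y\<in>Y. residual r f' g' T y l * g' y c) = (\<Sum>x\<in>X. residual r f g T x l * g x c)"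
    if "c < r" "l < s" for c l
    by (subst tr[symmetric]) (simp add: assms(4) that)
  moreover have "(\<Sum>y\<in>Y. \<Sum>l<s. (residual r f' g' T y l)\<^sup>2) = (\<Sum>x\<in>X. \<Sum>l<s. (residual r f g T x l)\<^sup>2)"
    by (subst tr[symmetric]) simp
  ultimately show ?thesis
    using assms(2) by (simp add: ortho_factor_def orthonormal_cols_def)
qed

section \<open>Factorization steps on cores and sweeps of steps\<close>

abbreviation core_rows :: "core \<Rightarrow> (nat \<times> nat) set" where
  "core_rows G \<equiv> {..<crow G} \<times> {..<cmid G}"

abbreviation core_ent :: "core \<Rightarrow> nat \<times> nat \<Rightarrow> nat \<Rightarrow> real" where
  "core_ent G x b \<equiv> cent G (fst x) (snd x) b"

text \<open>Right-orthonormality has no definition of its own; it is written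
  \<open>left_orth (core_transpose G)\<close>.\<close>

definition left_orth :: "core \<Rightarrow> bool" where
  "left_orth G \<longleftrightarrow> orthonormal_cols (core_rows G) (ccol G) (core_ent G)"

definition core_factor :: "real \<Rightarrow> core \<Rightarrow> core \<Rightarrow> (nat \<Rightarrow> nat \<Rightarrow> real) \<Rightarrow> bool" where
  "core_factor \<delta> G G' T \<longleftrightarrow> crow G' = crow G \<and> cmid G' = cmid G \<and>
     ortho_factor \<delta> (core_rows G) (ccol G) (core_ent G) (ccol G') (core_ent G') T"

text \<open>Only entries inside the index ranges are prescribed, since a core is a total function
  with arbitrary values elsewhere.\<close>

definition core_mult :: "nat \<Rightarrow> (nat \<Rightarrow> nat \<Rightarrow> real) \<Rightarrow> core \<Rightarrow> core \<Rightarrow> bool" where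
  "core_mult r T H H' \<longleftrightarrow> crow H' = r \<and> cmid H' = cmid H \<and> ccol H' = ccol H \<and>
     (\<forall>c<r. \<forall>i<cmid H. \<forall>b<ccol H. cent H' c i b = (\<Sum>x<crow H. T c x * cent H x i b))"

text \<open>Positions count from 0: core \<open>j\<close> is replaced by its orthonormal factor and
  core \<open>Suc j\<close> absorbs \<open>T\<close>. The rule \<open>there\<close> lets proofs
  strip untouched cores from the left.\<close>

inductive left_step :: "real \<Rightarrow> nat \<Rightarrow> core list \<Rightarrow> core list \<Rightarrow> bool" for \<delta> where
  here: "core_factor \<delta> G G' T \<Longrightarrow> core_mult (ccol G') T H H' \<Longrightarrow>
    left_step \<delta> 0 (G # H # S) (G' # H' # S)"
| there: "left_step \<delta> j Gs Gs' \<Longrightarrow> left_step \<delta> (Suc j) (G # Gs) (G # Gs')"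

inductive_cases left_step_0E: "left_step \<delta> 0 Gs Gs'"
inductive_cases left_step_SucE: "left_step \<delta> (Suc j) (G # Gs) Gs'"

lemma left_step_wf: "left_step \<delta> j Gs Gs' \<Longrightarrow> tt_wf r ns Gs s \<Longrightarrow> tt_wf r ns Gs' s"
proof (induction arbitrary: r ns rule: left_step.induct)
  case (here G G' T H H' S)
  then show ?case
    by (auto elim!: tt_wf_ConsE simp: core_factor_def core_mult_def)
next
  case (there j Gs Gs' G)
  then show ?case
    by (cases ns) auto
qed

lemma tt_mat_core_mult:
  assumes "core_mult r T H H'" "c < r" "i < cmid H" "tt_wf (ccol H) ns S s"
  shows "tt_mat (H' # S) (i # is) c b = (\<Sum>x<crow H. T c x * tt_mat (H # S) (i # is) x b)"
proof -
  have "tt_mat (H' # S) (i # is) c b =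
      (\<Sum>y<ccol H. \<Sum>x<crow H. T c x * cent H x i y * tt_mat S is y b)"
    using assms by (simp add: core_mult_def sum_distrib_right)
  also have "\<dots> = (\<Sum>x<crow H. \<Sum>y<ccol H. T c x * cent H x i y * tt_mat S is y b)"
    by (rule sum.swap)
  finally show ?thesis
    by (simp add: sum_distrib_left mult.assoc)
qed

text \<open>Zero tolerance forces \<open>G = G'T\<close>, and moving \<open>T\<close> over to the
  next core is associativity. This covers Depar and QR.\<close>

lemma left_step_exact:
  assumes "left_step 0 j Gs Gs'" "tt_wf r ns Gs s" "is \<in> idxs ns" "a < r"
  shows "tt_mat Gs' is a b = tt_mat Gs is a b"
  using assms
proof (induction arbitrary: r ns a "is" rule: left_step.induct)
  case (here G G' T H H' S)
  obtain n m ms where ns: "ns = n # m # ms"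
    using here(3) by (auto elim!: tt_wf_ConsE)
  obtain i i' is' where [simp]: "is = i # i' # is'" and "i < n" "i' < m" "is' \<in> idxs ms"
    using here(4) unfolding ns by (auto simp: idxs_Cons)
  have [simp]: "crow H = ccol G" "cmid H = m" and wf: "tt_wf (ccol H) ms S s"
    using here(3) ns by auto
  have fac: "cent G a i l = (\<Sum>c<ccol G'. cent G' a i c * T c l)" if "l < ccol G" for l
    using ortho_factor_exact[of "core_rows G" "ccol G" "core_ent G" "ccol G'" "core_ent G'" T "(a, i)" l]
      here(1,3,5) that \<open>i < n\<close> ns by (auto simp: core_factor_def)
  have "tt_mat (G' # H' # S) is a b = (\<Sum>c<ccol G'. \<Sum>l<ccol G.
      cent G' a i c * T c l * tt_mat (H # S) (i' # is') l b)"
    using here(2) \<open>i' < m\<close> wf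
    by (simp add: tt_mat_core_mult[OF here(2)] sum_distrib_left mult_ac del: tt_mat.simps(1)
          add: tt_mat.simps(1)[of G'])
  also have "\<dots> = (\<Sum>l<ccol G. \<Sum>c<ccol G'. cent G' a i c * T c l * tt_mat (H # S) (i' # is') l b)"
    by (rule sum.swap)
  also have "\<dots> = tt_mat (G # H # S) is a b"
    by (simp add: fac sum_distrib_right del: tt_mat.simps(1) add: tt_mat.simps(1)[of G])
  finally show ?case .
next
  case (there j Gs Gs' G)
  then obtain n ns' i is' where [simp]: "ns = n # ns'" "is = i # is'" and "is' \<in> idxs ns'"
    by (cases ns) (auto simp: idxs_Cons)
  with there show ?case
    by auto
qed

lemma chain_left_step_exact:
  assumes "chain (left_step 0) ks Gs Gs'" "tt_wf r ns Gs s" "is \<in> idxs ns" "a < r"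
  shows "tt_mat Gs' is a b = tt_mat Gs is a b"
  using assms
proof (induction ks arbitrary: Gs)
  case (Cons k ks)
  then obtain Z where Z: "left_step 0 k Gs Z" "chain (left_step 0) ks Z Gs'"
    by auto
  show ?case
    using Cons.IH[OF Z(2) left_step_wf[OF Z(1)]] left_step_exact[OF Z(1)] Cons.prems by simp
qed simp

lemma chain_map_Suc:
  "chain (left_step \<delta>) (map Suc ks) (G # Gs) Bs \<Longrightarrow>
    \<exists>Bs'. Bs = G # Bs' \<and> chain (left_step \<delta>) ks Gs Bs'"
proof (induction ks arbitrary: Gs)
  case (Cons k ks)
  then obtain Z where Z: "left_step \<delta> (Suc k) (G # Gs) Z" "chain (left_step \<delta>) (map Suc ks) Z Bs"
    by auto
  from Z(1) obtain Gs' where "Z = G # Gs'" "left_step \<delta> k Gs Gs'"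
    by (rule left_step_SucE) auto
  then show ?case
    using Z(2) Cons.IH by (metis chain.simps(2))
qed simp

text \<open>After the first step the head is final, and the rest is a shorter sweep on
  \<open>H' # S\<close>; this gives the induction of the error bound its shape.\<close>

lemma chain_upt_0_Suc:
  assumes "chain (left_step \<delta>) [0..<Suc n] Gs Bs"
  obtains G H S G' T H' Y where "Gs = G # H # S" "Bs = G' # Y" "core_factor \<delta> G G' T"
    "core_mult (ccol G') T H H'" "chain (left_step \<delta>) [0..<n] (H' # S) Y"
proof -
  have "[0..<Suc n] = 0 # map Suc [0..<n]"
    by (simp add: map_Suc_upt upt_conv_Cons del: upt_Suc)
  then obtain Z where Z: "left_step \<delta> 0 Gs Z" "chain (left_step \<delta>) (map Suc [0..<n]) Z Bs"
    using assms by auto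
  from Z(1) show ?thesis
  proof (rule left_step_0E)
    fix G G' T H H' S
    assume *: "Gs = G # H # S" "Z = G' # H' # S" "core_factor \<delta> G G' T" "core_mult (ccol G') T H H'"
    obtain Y where "Bs = G' # Y" "chain (left_step \<delta>) [0..<n] (H' # S) Y"
      using chain_map_Suc Z(2) unfolding *(2) by blast
    then show ?thesis
      using that * by blast
  qed
qed

lemma left_step_unchanged:
  "left_step \<delta> j Gs Gs' \<Longrightarrow> k \<noteq> j \<Longrightarrow> k \<noteq> Suc j \<Longrightarrow> Gs' ! k = Gs ! k"
  by (induction arbitrary: k rule: left_step.induct) (auto simp: nth_Cons split: nat.splits)

lemma left_step_left_orth: "left_step \<delta> j Gs Gs' \<Longrightarrow> left_orth (Gs' ! j)"
  by (induction rule: left_step.induct) (auto simp: core_factor_def left_orth_def ortho_factor_def)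

text \<open>Core \<open>n\<close> is excluded although position \<open>n\<close> is not swept: it
  absorbs the last remainder factor.\<close>

lemma sweep_unchanged:
  "chain (left_step \<delta>) [m..<n] Gs Gs' \<Longrightarrow> k < m \<or> n < k \<Longrightarrow> Gs' ! k = Gs ! k"
proof (induction "n - m" arbitrary: m Gs)
  case (Suc l)
  then obtain Z where "left_step \<delta> m Gs Z" "chain (left_step \<delta>) [Suc m..<n] Z Gs'"
    by (auto simp: upt_conv_Cons)
  moreover have "l = n - Suc m" "k \<noteq> m" "k \<noteq> Suc m" "k < Suc m \<or> n < k"
    using Suc(2,4) by auto
  ultimately show ?case
    using Suc(1)[of "Suc m" Z] left_step_unchanged[of \<delta> m Gs Z k] by simp
qed simp

text \<open>Core \<open>k\<close> becomes orthonormal in step \<open>k\<close>, and all later steps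
  act on larger positions.\<close>

lemma sweep_left_orth:
  "chain (left_step \<delta>) [m..<n] Gs Gs' \<Longrightarrow> m \<le> k \<Longrightarrow> k < n \<Longrightarrow> left_orth (Gs' ! k)"
proof (induction "n - m" arbitrary: m Gs)
  case (Suc l)
  then obtain Z where Z: "left_step \<delta> m Gs Z" "chain (left_step \<delta>) [Suc m..<n] Z Gs'"
    by (auto simp: upt_conv_Cons)
  show ?case
  proof (cases "k = m")
    case True
    then show ?thesis
      using sweep_unchanged[OF Z(2), of k] left_step_left_orth[OF Z(1)] by simp
  next
    case False
    then show ?thesis
      using Suc(1)[OF _ Z(2)] Suc(2,4,5) by simp
  qed
qed simp

section \<open>Pythagoras along a sweep\<close>

lemma gram_right_orth:
  assumes "tt_wf r ns Gs 1" "\<And>G. G \<in> set Gs \<Longrightarrow> left_orth (core_transpose G)" "a < r" "a' < r"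
  shows "(\<Sum>is\<in>idxs ns. tt_mat Gs is a 0 * tt_mat Gs is a' 0) = of_bool (a = a')"
  using assms
proof (induction r ns Gs "1 :: nat" arbitrary: a a' rule: tt_wf.induct)
  case (2 r n ns G Gs)
  then have IH: "(\<Sum>is\<in>idxs ns. tt_mat Gs is c 0 * tt_mat Gs is c' 0) = of_bool (c = c')"
    if "c < ccol G" "c' < ccol G" for c c'
    using that by auto
  have "left_orth (core_transpose G)"
    using 2 by simp
  then have orth: "(\<Sum>b<ccol G. \<Sum>i<n. cent G a i b * cent G a' i b) = of_bool (a = a')"
    using 2 by (simp add: left_orth_def orthonormal_cols_def sum_lessThan_times)
  \<comment> \<open>Summation over the remaining modes comes first: by induction it turns the double
    sum over \<open>c\<close> and \<open>c'\<close> into a single one, which is the Gram matrix of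
    the rows of the first core's R-unfolding.\<close>
  have "(\<Sum>is\<in>idxs (n # ns). tt_mat (G # Gs) is a 0 * tt_mat (G # Gs) is a' 0) =
     (\<Sum>c<ccol G. \<Sum>c'<ccol G. (\<Sum>i<n. cent G a i c * cent G a' i c') *
        (\<Sum>is\<in>idxs ns. tt_mat Gs is c 0 * tt_mat Gs is c' 0))"
    by (simp add: sum_idxs_Cons sum_bilinear)
  also have "\<dots> = (\<Sum>c<ccol G. \<Sum>i<n. cent G a i c * cent G a' i c)"
    by (simp add: IH cong: sum.cong_simp)
  finally show ?case
    using orth by simp
qed auto

text \<open>Expansion of the square leaves the Gram matrix of \<open>g\<close>, here the identity,
  so only the diagonal survives.\<close>

lemma sum_square_bilinear:
  fixes f :: "'x \<Rightarrow> nat \<Rightarrow> real" and g :: "nat \<Rightarrow> 'y \<Rightarrow> real"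
  assumes "\<And>b c. b < r \<Longrightarrow> c < r \<Longrightarrow> (\<Sum>y\<in>Y. g b y * g c y) = of_bool (b = c)"
  shows "(\<Sum>x\<in>X. \<Sum>y\<in>Y. (\<Sum>b<r. f x b * g b y)\<^sup>2) = (\<Sum>x\<in>X. \<Sum>b<r. (f x b)\<^sup>2)"
proof -
  have "(\<Sum>x\<in>X. \<Sum>y\<in>Y. (\<Sum>b<r. f x b * g b y)\<^sup>2) =
      (\<Sum>b<r. \<Sum>c<r. (\<Sum>x\<in>X. f x b * f x c) * (\<Sum>y\<in>Y. g b y * g c y))"
    by (simp add: power2_eq_square sum_bilinear)
  also have "\<dots> = (\<Sum>b<r. \<Sum>x\<in>X. (f x b)\<^sup>2)"
    by (simp add: assms power2_eq_square cong: sum.cong_simp)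
  also have "\<dots> = (\<Sum>x\<in>X. \<Sum>b<r. (f x b)\<^sup>2)"
    by (rule sum.swap)
  finally show ?thesis .
qed

lemma sum_square_orthonormal:
  assumes "orthonormal_cols X r f"
  shows "(\<Sum>x\<in>X. \<Sum>y\<in>Y. (\<Sum>b<r. f x b * g b y)\<^sup>2) = (\<Sum>b<r. \<Sum>y\<in>Y. (g b y)\<^sup>2)"
proof -
  have "(\<Sum>x\<in>X. \<Sum>y\<in>Y. (\<Sum>b<r. f x b * g b y)\<^sup>2) = (\<Sum>y\<in>Y. \<Sum>x\<in>X. (\<Sum>b<r. g b y * f x b)\<^sup>2)"
    by (subst sum.swap) (simp add: mult.commute)
  also have "\<dots> = (\<Sum>y\<in>Y. \<Sum>b<r. (g b y)\<^sup>2)"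
    by (rule sum_square_bilinear) (use assms in \<open>simp add: orthonormal_cols_def\<close>)
  also have "\<dots> = (\<Sum>b<r. \<Sum>y\<in>Y. (g b y)\<^sup>2)"
    by (rule sum.swap)
  finally show ?thesis .
qed

text \<open>A squared distance. The left index stays open because sweeps are analysed after removal
  of leading cores; the right rank is always 1, hence the index 0.\<close>

definition tt_dist2 :: "nat \<Rightarrow> nat list \<Rightarrow> core list \<Rightarrow> core list \<Rightarrow> real" where
  "tt_dist2 r ns Gs Bs = (\<Sum>a<r. \<Sum>is\<in>idxs ns. (tt_mat Gs is a 0 - tt_mat Bs is a 0)\<^sup>2)"

lemma tt_dist2_Cons:
  "tt_dist2 (crow G) (cmid G # ns) Gs Bs =
    (\<Sum>x\<in>core_rows G. \<Sum>is\<in>idxs ns.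
       (tt_mat Gs (snd x # is) (fst x) 0 - tt_mat Bs (snd x # is) (fst x) 0)\<^sup>2)"
  by (simp add: tt_dist2_def sum_idxs_Cons sum_lessThan_times)

text \<open>With \<open>G = G'T + E\<close>, the difference of the two trains is \<open>E W + G' (X - Y)\<close>, where
  \<open>W\<close>, \<open>X\<close>, \<open>Y\<close> are the remaining trains before the step, after it, and after the whole sweep.
  The two summands are orthogonal because \<open>G'\<^sup>T E = 0\<close>.\<close>
lemma sweep_from_0_bound:
  assumes "chain (left_step \<delta>) [0..<n] Gs Bs" "tt_wf r ns Gs 1"
    and "\<And>H. H \<in> set (tl Gs) \<Longrightarrow> left_orth (core_transpose H)"
  shows "tt_dist2 r ns Gs Bs \<le> n * \<delta>\<^sup>2"
  using assms
proof (induction n arbitrary: Gs Bs r ns)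
  case 0
  then show ?case
    by (simp add: tt_dist2_def)
next
  case (Suc n)
  from Suc.prems(1) obtain G H S G' T H' Y where
    Gs: "Gs = G # H # S" "Bs = G' # Y" and fac: "core_factor \<delta> G G' T"
    and mult: "core_mult (ccol G') T H H'" and ch: "chain (left_step \<delta>) [0..<n] (H' # S) Y"
    by (rule chain_upt_0_Suc)
  obtain m ms where ns: "ns = cmid G # m # ms" and m: "cmid H = m" "crow H = ccol G" "crow G = r"
    and wfS: "tt_wf (ccol H) ms S 1"
    using Suc.prems(2) unfolding Gs by (auto elim!: tt_wf_ConsE)
  let ?X = "core_rows G" and ?Y = "idxs (m # ms)" and ?q = "ccol G'"
  define E where "E = residual ?q (core_ent G) (core_ent G') T"
  define W where "W b is = tt_mat (H # S) is b 0" for b "is"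
  define Z where "Z c is = tt_mat (H' # S) is c 0 - tt_mat Y is c 0" for c "is"
  have orth: "orthonormal_cols ?X ?q (core_ent G')"
    and perp: "\<And>l c. l < ccol G \<Longrightarrow> c < ?q \<Longrightarrow> (\<Sum>x\<in>?X. E x l * core_ent G' x c) = 0"
    and small: "(\<Sum>x\<in>?X. \<Sum>l<ccol G. (E x l)\<^sup>2) \<le> \<delta>\<^sup>2"
    using fac by (simp_all add: core_factor_def ortho_factor_def E_def)
  \<comment> \<open>\<open>W\<close> is built from the cores before the step, so \<open>H\<close>
    has not yet absorbed \<open>T\<close> and all of them are right-orthonormal.\<close>
  have gram: "(\<Sum>y\<in>?Y. W b y * W c y) = of_bool (b = c)" if "b < ccol G" "c < ccol G" for b c
    unfolding W_def by (rule gram_right_orth) (use Suc.prems(3) Gs wfS m that in auto)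
  have diff: "tt_mat Gs (snd x # is) (fst x) 0 - tt_mat Bs (snd x # is) (fst x) 0 =
      (\<Sum>b<ccol G. E x b * W b is) + (\<Sum>c<?q. core_ent G' x c * Z c is)"
    if "x \<in> ?X" and Y: "is \<in> ?Y" for x "is"
  proof -
    obtain i is' where is': "is = i # is'" "i < m"
      using Y by (auto simp: idxs_Cons)
    have X: "tt_mat (H' # S) is c 0 = (\<Sum>b<ccol G. T c b * W b is)" if "c < ?q" for c
      unfolding is' W_def using tt_mat_core_mult[OF mult that _ wfS] is' m by simp
    have "(\<Sum>c<?q. core_ent G' x c * tt_mat (H' # S) is c 0) =
        (\<Sum>c<?q. \<Sum>b<ccol G. core_ent G' x c * T c b * W b is)"
      by (simp add: X sum_distrib_left mult_ac)
    also have "\<dots> = (\<Sum>b<ccol G. \<Sum>c<?q. core_ent G' x c * T c b * W b is)"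
      by (rule sum.swap)
    finally show ?thesis
      unfolding Gs Z_def E_def residual_def
      by (simp add: W_def left_diff_distrib right_diff_distrib sum_subtractf sum_distrib_right
          del: tt_mat.simps(1) add: tt_mat.simps(1)[of G] tt_mat.simps(1)[of G'])
  qed
  have "tt_dist2 r ns Gs Bs = (\<Sum>x\<in>?X. \<Sum>is\<in>?Y.
     ((\<Sum>b<ccol G. E x b * W b is) + (\<Sum>c<?q. core_ent G' x c * Z c is))\<^sup>2)"
    unfolding ns m(3)[symmetric] tt_dist2_Cons by (intro sum.cong refl) (simp add: diff)
  also have "\<dots> = (\<Sum>x\<in>?X. \<Sum>is\<in>?Y. (\<Sum>b<ccol G. E x b * W b is)\<^sup>2) +
      (\<Sum>x\<in>?X. \<Sum>is\<in>?Y. (\<Sum>c<?q. core_ent G' x c * Z c is)\<^sup>2) +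
      2 * (\<Sum>x\<in>?X. \<Sum>is\<in>?Y. (\<Sum>b<ccol G. E x b * W b is) * (\<Sum>c<?q. core_ent G' x c * Z c is))"
    by (rule sum_power2_add)
  also have "(\<Sum>x\<in>?X. \<Sum>is\<in>?Y. (\<Sum>b<ccol G. E x b * W b is) * (\<Sum>c<?q. core_ent G' x c * Z c is)) = 0"
    unfolding sum_bilinear by (simp add: perp)
  also have "(\<Sum>x\<in>?X. \<Sum>is\<in>?Y. (\<Sum>b<ccol G. E x b * W b is)\<^sup>2) = (\<Sum>x\<in>?X. \<Sum>l<ccol G. (E x l)\<^sup>2)"
    by (rule sum_square_bilinear) (rule gram)
  \<comment> \<open>The orthonormal \<open>G'\<close> drops out, and what remains is the distance
    for the shorter train that starts with \<open>H'\<close>.\<close>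
  also have "(\<Sum>x\<in>?X. \<Sum>is\<in>?Y. (\<Sum>c<?q. core_ent G' x c * Z c is)\<^sup>2) = tt_dist2 ?q (m # ms) (H' # S) Y"
    unfolding tt_dist2_def by (subst sum_square_orthonormal[OF orth]) (simp add: Z_def)
  \<comment> \<open>The orthonormality hypothesis concerns only the tail, so the induction applies
    although \<open>H'\<close> has absorbed \<open>T\<close> and need not be
    right-orthonormal.\<close>
  also have "\<dots> \<le> n * \<delta>\<^sup>2"
    by (rule Suc.IH[OF ch]) (use mult wfS m Gs Suc.prems(3) in \<open>auto simp: core_mult_def\<close>)
  finally show ?case
    using small by (simp add: algebra_simps)
qed

text \<open>By induction on \<open>m\<close>: both trains share the orthonormal head
  \<open>G\<close>, so their difference is \<open>G\<close> times the difference of the tails and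
  has the same norm. The conditions leave out \<open>k = m\<close>, the active core.\<close>

lemma sweep_bound:
  assumes "chain (left_step \<delta>) [m..<m + n] Gs Bs" "tt_wf r ns Gs 1" "m < length Gs"
    and "\<And>k. k < m \<Longrightarrow> left_orth (Gs ! k)"
    and "\<And>k. m < k \<Longrightarrow> k < length Gs \<Longrightarrow> left_orth (core_transpose (Gs ! k))"
  shows "tt_dist2 r ns Gs Bs \<le> n * \<delta>\<^sup>2"
  using assms
proof (induction m arbitrary: Gs Bs r ns)
  case 0
  have "left_orth (core_transpose H)" if "H \<in> set (tl Gs)" for H
    using that 0(5) by (auto simp: in_set_conv_nth nth_tl)
  then show ?case
    using 0 sweep_from_0_bound by simp
next
  case (Suc m)
  obtain G Gs' where G: "Gs = G # Gs'"
    using Suc.prems(3) by (cases Gs) auto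
  obtain ns' where ns: "ns = cmid G # ns'" and wf: "tt_wf (ccol G) ns' Gs' 1" "crow G = r"
    using Suc.prems(2) unfolding G by (cases ns) auto
  have "[Suc m..<Suc m + n] = map Suc [m..<m + n]"
    by (simp add: map_Suc_upt)
  then obtain Bs' where B: "Bs = G # Bs'" "chain (left_step \<delta>) [m..<m + n] Gs' Bs'"
    using Suc.prems(1) chain_map_Suc unfolding G by metis
  have "left_orth G"
    using Suc.prems(4)[of 0] G by simp
  then have "tt_dist2 r ns Gs Bs = tt_dist2 (ccol G) ns' Gs' Bs'"
    unfolding wf(2)[symmetric] ns tt_dist2_Cons G B left_orth_def
    by (simp add: sum_subtractf[symmetric] right_diff_distrib[symmetric] sum_square_orthonormal)
      (simp add: tt_dist2_def)
  also have "\<dots> \<le> n * \<delta>\<^sup>2"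
    using Suc.prems(3) Suc.prems(4)[of "Suc _"] Suc.prems(5)[of "Suc _"]
    by (intro Suc.IH[OF B(2) wf(1)]) (auto simp: G)
  finally show ?case .
qed

section \<open>Matrix factorizations of the unfoldings\<close>

definition mat_factor :: "real \<Rightarrow> real mat \<Rightarrow> real mat \<Rightarrow> real mat \<Rightarrow> bool" where
  "mat_factor \<delta> M U T \<longleftrightarrow> dim_row U = dim_row M \<and> dim_row T = dim_col U \<and> dim_col T = dim_col M \<and>
     ortho_factor \<delta> {..<dim_row M} (dim_col M) (\<lambda>x l. M $$ (x, l)) (dim_col U) (\<lambda>x c. U $$ (x, c))
       (\<lambda>c l. T $$ (c, l))"

lemma mult_add_less:
  fixes a i m n :: nat
  assumes "a < m" "i < n"
  shows "a * n + i < m * n"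
proof -
  have "a * n + i < Suc a * n"
    using assms by simp
  also have "\<dots> \<le> m * n"
    using assms by (intro mult_right_mono) auto
  finally show ?thesis .
qed

lemma mod_less_of_less_mult: "r < m * n \<Longrightarrow> r mod n < n" for r m n :: nat
  by (cases n) auto

lemma bij_betw_mult_add:
  "bij_betw (\<lambda>x. fst x * n + snd x) ({..<m} \<times> {..<n}) {..<m * n}" for n :: nat
  by (rule bij_betw_byWitness[where f' = "\<lambda>r. (r div n, r mod n)"])
    (auto simp: mult_add_less less_mult_imp_div_less intro: mod_less_of_less_mult)

lemma bij_betw_div_mod:
  "bij_betw (\<lambda>r. (r div n, r mod n)) {..<m * n} ({..<m} \<times> {..<n})" for n :: nat
  by (rule bij_betw_byWitness[where f' = "\<lambda>x. fst x * n + snd x"])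
    (auto simp: mult_add_less less_mult_imp_div_less intro: mod_less_of_less_mult)

text \<open>Rows of the transposed R-unfolding are numbered with the mode index in front, whereas
  rows of the transposed core are pairs with the rank index in front; hence the swap.\<close>

lemma bij_betw_mult_add_swap:
  "bij_betw (\<lambda>x. snd x * n + fst x) ({..<n} \<times> {..<m}) {..<m * n}" for n :: nat
  by (rule bij_betw_byWitness[where f' = "\<lambda>r. (r mod n, r div n)"])
    (auto simp: mult_add_less less_mult_imp_div_less intro: mod_less_of_less_mult)

lemma bij_betw_mod_div:
  "bij_betw (\<lambda>r. (r mod n, r div n)) {..<m * n} ({..<n} \<times> {..<m})" for n :: nat
  by (rule bij_betw_byWitness[where f' = "\<lambda>x. snd x * n + fst x"])
    (auto simp: mult_add_less less_mult_imp_div_less intro: mod_less_of_less_mult)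

text \<open>The positive mode size lets \<open>of_Lunf\<close> recover the left rank by dividing the
  number of rows by it.\<close>

lemma core_factor_Lunf:
  assumes "mat_factor \<delta> (Lunf G) U T" "0 < cmid G"
  shows "core_factor \<delta> G (of_Lunf (cmid G) U) (\<lambda>c l. T $$ (c, l))"
proof -
  have dims: "dim_row U = crow G * cmid G"
    and fac: "ortho_factor \<delta> {..<crow G * cmid G} (ccol G) (\<lambda>x l. Lunf G $$ (x, l)) (dim_col U)
       (\<lambda>x c. U $$ (x, c)) (\<lambda>c l. T $$ (c, l))"
    using assms by (auto simp: mat_factor_def Lunf_def)
  have "ortho_factor \<delta> (core_rows G) (ccol G) (core_ent G) (dim_col U)
       (core_ent (of_Lunf (cmid G) U)) (\<lambda>c l. T $$ (c, l))"
    by (rule ortho_factor_reindex[OF bij_betw_mult_add fac])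
      (auto simp: Lunf_def of_Lunf_def mult_add_less)
  then show ?thesis
    using dims assms(2) by (simp add: core_factor_def of_Lunf_def)
qed

lemma core_factor_Runf:
  assumes "mat_factor \<delta> (transpose_mat (Runf G)) U T" "0 < cmid G"
  shows "core_factor \<delta> (core_transpose G) (core_transpose (of_Runf (cmid G) (transpose_mat U)))
    (\<lambda>c l. T $$ (c, l))"
proof -
  have dims: "dim_row U = cmid G * ccol G"
    and fac: "ortho_factor \<delta> {..<cmid G * ccol G} (crow G) (\<lambda>x l. transpose_mat (Runf G) $$ (x, l))
       (dim_col U) (\<lambda>x c. U $$ (x, c)) (\<lambda>c l. T $$ (c, l))"
    using assms by (auto simp: mat_factor_def Runf_def)
  have "ortho_factor \<delta> (core_rows (core_transpose G)) (crow G) (core_ent (core_transpose G)) (dim_col U)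
       (core_ent (core_transpose (of_Runf (cmid G) (transpose_mat U)))) (\<lambda>c l. T $$ (c, l))"
    unfolding core_transpose_simps
    by (rule ortho_factor_reindex[OF bij_betw_mult_add_swap fac])
      (use assms(2) dims in \<open>auto simp: Runf_def of_Runf_def mult_add_less\<close>)
  then show ?thesis
    using dims assms(2) by (simp add: core_factor_def of_Runf_def)
qed

section \<open>From matrix updates to steps on trains\<close>

lemma core_mult_map_slices:
  assumes "dim_col T = crow H"
  shows "core_mult (dim_row T) (\<lambda>c l. T $$ (c, l)) H
    (map_slices (dim_row T) (ccol H) (\<lambda>X. T * X) H)"
  using assms by (auto simp: core_mult_def map_slices_def slice_def scalar_prod_def lessThan_atLeast0)

lemma core_mult_transpose_map_slices:
  assumes "dim_col T = ccol H"
  shows "core_mult (dim_row T) (\<lambda>c l. T $$ (c, l)) (core_transpose H)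
    (core_transpose (map_slices (crow H) (dim_row T) (\<lambda>X. X * transpose_mat T) H))"
  using assms by (auto simp: core_mult_def map_slices_def slice_def scalar_prod_def lessThan_atLeast0
      mult.commute)

lemma left_stepI:
  "Suc j < length Gs \<Longrightarrow> core_factor \<delta> (Gs ! j) G' T \<Longrightarrow> core_mult (ccol G') T (Gs ! Suc j) H' \<Longrightarrow>
    left_step \<delta> j Gs (Gs[j := G', Suc j := H'])"
proof (induction j arbitrary: Gs)
  case 0
  then obtain G H S where "Gs = G # H # S"
    by (cases Gs; cases "tl Gs") auto
  then show ?case
    using 0 by (auto intro: left_step.here)
next
  case (Suc j)
  then show ?case
    by (cases Gs) (auto intro: left_step.there)
qed

lemma left_step_Lunf:
  assumes "tt_wf r ns Gs s" "Suc j < length Gs" "0 < cmid (Gs ! j)" "mat_factor \<delta> (Lunf (Gs ! j)) U T"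
  shows "left_step \<delta> j Gs (Gs[j := of_Lunf (cmid (Gs ! j)) U,
    Suc j := map_slices (dim_row T) (ccol (Gs ! Suc j)) (\<lambda>X. T * X) (Gs ! Suc j)])"
proof (rule left_stepI)
  have "dim_col T = crow (Gs ! Suc j)" "dim_row T = dim_col U"
    using assms(4) tt_wf_link[OF assms(1), of j] assms(2) tt_wf_length[OF assms(1)]
    by (auto simp: mat_factor_def Lunf_def)
  then show "core_mult (ccol (of_Lunf (cmid (Gs ! j)) U)) (\<lambda>c l. T $$ (c, l)) (Gs ! Suc j)
      (map_slices (dim_row T) (ccol (Gs ! Suc j)) (\<lambda>X. T * X) (Gs ! Suc j))"
    using core_mult_map_slices[of T "Gs ! Suc j"] by (simp add: of_Lunf_def)
qed (use assms core_factor_Lunf in auto)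

lemma tt_transpose_update:
  "k < length Gs \<Longrightarrow> tt_transpose (Gs[k := G]) = (tt_transpose Gs)[length Gs - Suc k := core_transpose G]"
  by (simp add: tt_transpose_def map_update rev_update)

text \<open>Reversal puts core \<open>Suc j\<close> at position
  \<open>length Gs - Suc (Suc j)\<close> and core \<open>j\<close> right after it, so an update that
  moves from \<open>Suc j\<close> to \<open>j\<close> becomes a step to the right.\<close>

lemma left_step_Runf:
  assumes "tt_wf r ns Gs s" "Suc j < length Gs" "0 < cmid (Gs ! Suc j)"
    and "mat_factor \<delta> (transpose_mat (Runf (Gs ! Suc j))) U T"
  shows "left_step \<delta> (length Gs - Suc (Suc j)) (tt_transpose Gs)
    (tt_transpose (Gs[Suc j := of_Runf (cmid (Gs ! Suc j)) (transpose_mat U),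
      j := map_slices (crow (Gs ! j)) (dim_row T) (\<lambda>X. X * transpose_mat T) (Gs ! j)]))"
proof -
  let ?l = "length Gs - Suc (Suc j)"
  have l: "length Gs - Suc j = Suc ?l" "Suc ?l < length Gs"
    using assms(2) by auto
  have nth: "tt_transpose Gs ! ?l = core_transpose (Gs ! Suc j)"
    "tt_transpose Gs ! Suc ?l = core_transpose (Gs ! j)"
    using assms(2) by (simp_all add: nth_tt_transpose Suc_diff_Suc)
  have T: "dim_col T = ccol (Gs ! j)" "dim_row T = dim_col U"
    using assms(4) tt_wf_link[OF assms(1), of j] assms(2) tt_wf_length[OF assms(1)]
    by (auto simp: mat_factor_def Runf_def)
  show ?thesis
    using assms(2) l
    by (simp add: tt_transpose_update, intro left_stepI[where T = "\<lambda>c l. T $$ (c, l)"])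
      (use core_factor_Runf[OF assms(4,3)] core_mult_transpose_map_slices[OF T(1)] T(2) in
        \<open>simp_all add: nth of_Runf_def\<close>)
qed

section \<open>Orthonormal factors from truncated SVD and QR\<close>

lemma mat_factor_svd:
  assumes "is_trunc_svd \<delta> M U S V"
  shows "mat_factor \<delta> M U (S * transpose_mat V)"
    and "transpose_mat S = S" "S \<in> carrier_mat (dim_col U) (dim_col U)"
    and "V \<in> carrier_mat (dim_col M) (dim_col U)"
proof -
  define m n q where "m = dim_row M" and "n = dim_col M" and "q = min m n"
  from assms obtain \<sigma> u v r where svd:
    "(\<forall>i<q. u i \<in> carrier_vec m \<and> v i \<in> carrier_vec n) \<and>
     (\<forall>i<q. \<forall>j<q. u i \<bullet> u j = (if i = j then 1 else 0) \<and> v i \<bullet> v j = (if i = j then 1 else 0)) \<and>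
     (\<forall>i<q. 0 \<le> \<sigma> i) \<and> (\<forall>i j. i \<le> j \<longrightarrow> j < q \<longrightarrow> \<sigma> j \<le> \<sigma> i) \<and>
     (\<forall>a<m. \<forall>b<n. M $$ (a,b) = (\<Sum>i<q. \<sigma> i * (u i $ a) * (v i $ b))) \<and>
     r = (LEAST r. (\<Sum>i\<in>{r..<q}. (\<sigma> i)^2) \<le> \<delta>^2) \<and>
     U = mat m r (\<lambda>(a,i). u i $ a) \<and>
     S = mat r r (\<lambda>(i,j). if i = j then \<sigma> i else 0) \<and>
     V = mat n r (\<lambda>(b,i). v i $ b)"
    unfolding is_trunc_svd_def Let_def m_def[symmetric] n_def[symmetric] q_def[symmetric]
    by - (elim exE, rule that)
  then have uv: "\<And>i. i < q \<Longrightarrow> u i \<in> carrier_vec m" "\<And>i. i < q \<Longrightarrow> v i \<in> carrier_vec n"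
    and orth: "\<And>i j. i < q \<Longrightarrow> j < q \<Longrightarrow> u i \<bullet> u j = (if i = j then 1 else 0)"
      "\<And>i j. i < q \<Longrightarrow> j < q \<Longrightarrow> v i \<bullet> v j = (if i = j then 1 else 0)"
    and M: "\<And>a b. a < m \<Longrightarrow> b < n \<Longrightarrow> M $$ (a, b) = (\<Sum>i<q. \<sigma> i * (u i $ a) * (v i $ b))"
    by simp_all
  from svd have r: "r = (LEAST r. (\<Sum>i\<in>{r..<q}. (\<sigma> i)\<^sup>2) \<le> \<delta>\<^sup>2)"
    and U: "U = mat m r (\<lambda>(a, i). u i $ a)"
    and S: "S = mat r r (\<lambda>(i, j). if i = j then \<sigma> i else 0)"
    and V: "V = mat n r (\<lambda>(b, i). v i $ b)"
    by blast+
  \<comment> \<open>\<open>r = q\<close> leaves an empty tail, so the minimum in the definition of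
    \<open>r\<close> exists and is at most \<open>q\<close>.\<close>
  have "(\<Sum>i\<in>{q..<q}. (\<sigma> i)\<^sup>2) \<le> \<delta>\<^sup>2"
    by simp
  then have tail: "(\<Sum>i\<in>{r..<q}. (\<sigma> i)\<^sup>2) \<le> \<delta>\<^sup>2" and "r \<le> q"
    unfolding r by (rule LeastI, rule Least_le)
  have ou: "(\<Sum>x<m. u i $ x * u j $ x) = of_bool (i = j)" if "i < q" "j < q" for i j
    using orth(1)[OF that] uv(1)[OF that(2)] by (simp add: scalar_prod_def lessThan_atLeast0)
  have ov: "(\<Sum>x<n. v i $ x * v j $ x) = of_bool (i = j)" if "i < q" "j < q" for i j
    using orth(2)[OF that] uv(2)[OF that(2)] by (simp add: scalar_prod_def lessThan_atLeast0)
  have T: "(S * transpose_mat V) $$ (c, l) = \<sigma> c * v c $ l" if "c < r" "l < n" for c l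
    using that unfolding S V
    by (simp add: scalar_prod_def if_distrib[of "\<lambda>x. x * _"] cong: if_cong)
  define E where "E = residual r (\<lambda>x l. M $$ (x, l)) (\<lambda>x c. U $$ (x, c))
      (\<lambda>c l. (S * transpose_mat V) $$ (c, l))"
  have E: "E x l = (\<Sum>i\<in>{r..<q}. (\<sigma> i * u i $ x) * v i $ l)" if "x < m" "l < n" for x l
  proof -
    have "(\<Sum>i<q. \<sigma> i * u i $ x * v i $ l) =
        (\<Sum>i<r. \<sigma> i * u i $ x * v i $ l) + (\<Sum>i\<in>{r..<q}. \<sigma> i * u i $ x * v i $ l)"
      using \<open>r \<le> q\<close> by (subst sum.union_disjoint[symmetric]) (auto intro: sum.cong)
    moreover have "(\<Sum>c<r. U $$ (x, c) * (S * transpose_mat V) $$ (c, l)) =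
        (\<Sum>c<r. \<sigma> c * u c $ x * v c $ l)"
      using that by (intro sum.cong) (auto simp: T U)
    ultimately show ?thesis
      using that by (simp add: E_def residual_def M)
  qed
  \<comment> \<open>Orthonormality of the \<open>v i\<close> and then of the \<open>u i\<close>
    reduces the squared norm of the residual to the sum of the dropped squared singular
    values.\<close>
  have "(\<Sum>x<m. \<Sum>l<n. (E x l)\<^sup>2) = (\<Sum>x<m. \<Sum>l<n.
      (\<Sum>i\<in>{r..<q}. (\<sigma> i * u i $ x) * v i $ l) * (\<Sum>i\<in>{r..<q}. (\<sigma> i * u i $ x) * v i $ l))"
    by (simp add: E power2_eq_square)
  also have "\<dots> = (\<Sum>i\<in>{r..<q}. \<Sum>j\<in>{r..<q}.
      (\<Sum>x<m. (\<sigma> i * u i $ x) * (\<sigma> j * u j $ x)) * (\<Sum>l<n. v i $ l * v j $ l))"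
    by (rule sum_bilinear)
  also have "\<dots> = (\<Sum>i\<in>{r..<q}. \<Sum>x<m. (\<sigma> i * u i $ x)\<^sup>2)"
  proof (rule sum.cong[OF refl])
    fix i assume i: "i \<in> {r..<q}"
    have "(\<Sum>j\<in>{r..<q}. (\<Sum>x<m. (\<sigma> i * u i $ x) * (\<sigma> j * u j $ x)) * (\<Sum>l<n. v i $ l * v j $ l)) =
        (\<Sum>j\<in>{r..<q}. if i = j then \<Sum>x<m. (\<sigma> i * u i $ x)\<^sup>2 else 0)"
      using i by (intro sum.cong) (auto simp: ov power2_eq_square)
    then show "(\<Sum>j\<in>{r..<q}. (\<Sum>x<m. (\<sigma> i * u i $ x) * (\<sigma> j * u j $ x)) * (\<Sum>l<n. v i $ l * v j $ l)) =
        (\<Sum>x<m. (\<sigma> i * u i $ x)\<^sup>2)"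
      using i by simp
  qed
  also have "\<dots> = (\<Sum>i\<in>{r..<q}. (\<sigma> i)\<^sup>2)"
  proof (rule sum.cong[OF refl])
    fix i assume i: "i \<in> {r..<q}"
    have "(\<Sum>x<m. (\<sigma> i * u i $ x)\<^sup>2) = (\<sigma> i)\<^sup>2 * (\<Sum>x<m. u i $ x * u i $ x)"
      by (simp add: sum_distrib_left power2_eq_square mult_ac)
    then show "(\<Sum>x<m. (\<sigma> i * u i $ x)\<^sup>2) = (\<sigma> i)\<^sup>2"
      using i by (simp add: ou)
  qed
  finally have small: "(\<Sum>x<m. \<Sum>l<n. (E x l)\<^sup>2) \<le> \<delta>\<^sup>2"
    using tail by simp
  \<comment> \<open>Kept and dropped left singular vectors are orthogonal, since
    \<open>c < r \<le> i\<close>.\<close>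
  have perp: "(\<Sum>x<m. E x l * U $$ (x, c)) = 0" if "l < n" "c < r" for l c
  proof -
    have "(\<Sum>x<m. E x l * U $$ (x, c)) = (\<Sum>x<m. \<Sum>i\<in>{r..<q}. \<sigma> i * v i $ l * (u i $ x * u c $ x))"
      using that by (intro sum.cong refl, simp add: E U sum_distrib_right, simp add: mult_ac)
    also have "\<dots> = (\<Sum>i\<in>{r..<q}. \<sigma> i * v i $ l * (\<Sum>x<m. u i $ x * u c $ x))"
      by (subst sum.swap) (simp add: sum_distrib_left)
    also have "\<dots> = 0"
      using that \<open>r \<le> q\<close> by (intro sum.neutral) (auto simp: ou)
    finally show ?thesis .
  qed
  have "orthonormal_cols {..<m} r (\<lambda>x c. U $$ (x, c))"
    using \<open>r \<le> q\<close> by (auto simp: orthonormal_cols_def U ou)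
  then show "mat_factor \<delta> M U (S * transpose_mat V)"
    unfolding mat_factor_def ortho_factor_def m_def[symmetric] n_def[symmetric]
    using small perp by (simp add: E_def U S V)
  show "transpose_mat S = S" "S \<in> carrier_mat (dim_col U) (dim_col U)"
    "V \<in> carrier_mat (dim_col M) (dim_col U)"
    by (auto simp: S U V n_def)
qed

lemma mat_factor_exact:
  assumes "dim_row Q = dim_row M" "dim_row T = dim_col Q" "dim_col T = dim_col M"
    and "orthonormal_cols {..<dim_row M} (dim_col Q) (\<lambda>x c. Q $$ (x, c))"
    and "\<And>x l. x < dim_row M \<Longrightarrow> l < dim_col M \<Longrightarrow> M $$ (x, l) = (\<Sum>c<dim_col Q. Q $$ (x, c) * T $$ (c, l))"
  shows "mat_factor 0 M Q T"
  using assms by (simp add: mat_factor_def ortho_factor_def residual_def)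

lemma mat_factor_qr:
  assumes "is_econ_qr M Q R"
  shows "mat_factor 0 M Q R"
proof -
  define k where "k = min (dim_row M) (dim_col M)"
  have Q: "Q \<in> carrier_mat (dim_row M) k" and R: "R \<in> carrier_mat k (dim_col M)"
    and QQ: "transpose_mat Q * Q = 1\<^sub>m k" and M: "M = Q * R"
    using assms unfolding is_econ_qr_def Let_def k_def[symmetric] by auto
  show ?thesis
  proof (rule mat_factor_exact)
    have "(\<Sum>x<dim_row M. Q $$ (x, c) * Q $$ (x, c')) = (transpose_mat Q * Q) $$ (c, c')"
      if "c < k" "c' < k" for c c'
      using Q that by (simp add: scalar_prod_def lessThan_atLeast0)
    then show "orthonormal_cols {..<dim_row M} (dim_col Q) (\<lambda>x c. Q $$ (x, c))"
      using Q unfolding QQ orthonormal_cols_def by auto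
    show "M $$ (x, l) = (\<Sum>c<dim_col Q. Q $$ (x, c) * R $$ (c, l))"
      if "x < dim_row M" "l < dim_col M" for x l
      using that Q R by (subst M) (simp add: scalar_prod_def lessThan_atLeast0)
  qed (use Q R in auto)
qed

section \<open>Parallel-vector reduction of unit columns\<close>

text \<open>Column \<open>c\<close> has its only 1 in row \<open>\<rho> c\<close>. Repeated columns
  are allowed: absorbing \<open>T\<close> can make columns coincide, and they become distinct only
  through Depar.\<close>

definition unit_cols :: "'x set \<Rightarrow> nat \<Rightarrow> ('x \<Rightarrow> nat \<Rightarrow> real) \<Rightarrow> bool" where
  "unit_cols X r g \<longleftrightarrow> (\<exists>\<rho>. \<forall>c<r. \<rho> c \<in> X \<and> (\<forall>x\<in>X. g x c = of_bool (x = \<rho> c)))"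

lemma unit_cols_reindex:
  assumes "bij_betw h Y X" "unit_cols X r g" "\<And>y c. y \<in> Y \<Longrightarrow> c < r \<Longrightarrow> g' y c = g (h y) c"
  shows "unit_cols Y r g'"
proof -
  obtain \<rho> where \<rho>: "\<And>c. c < r \<Longrightarrow> \<rho> c \<in> X" "\<And>c x. c < r \<Longrightarrow> x \<in> X \<Longrightarrow> g x c = of_bool (x = \<rho> c)"
    using assms(2) by (auto simp: unit_cols_def)
  have "inv_into Y h (\<rho> c) \<in> Y \<and> (\<forall>y\<in>Y. g' y c = of_bool (y = inv_into Y h (\<rho> c)))" if "c < r" for c
  proof -
    have X: "\<rho> c \<in> h ` Y"
      using assms(1) \<rho>(1)[OF that] by (simp add: bij_betw_def)
    have "g' y c = of_bool (y = inv_into Y h (\<rho> c))" if y: "y \<in> Y" for y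
    proof -
      have "h y \<in> X"
        using assms(1) y by (auto simp: bij_betw_def)
      moreover have "h y = \<rho> c \<longleftrightarrow> y = inv_into Y h (\<rho> c)"
        using X y assms(1) by (auto simp: bij_betw_def f_inv_into_f dest: inj_onD)
      ultimately show ?thesis
        using assms(3)[OF y \<open>c < r\<close>] \<rho>(2)[OF \<open>c < r\<close>] by simp
    qed
    then show ?thesis
      using X by (simp add: inv_into_into)
  qed
  then show ?thesis
    unfolding unit_cols_def by (intro exI[of _ "\<lambda>c. inv_into Y h (\<rho> c)"]) auto
qed

text \<open>Entry \<open>q\<close> is 1 on the left and nonzero on the right only if
  \<open>q = q'\<close>, where it is \<open>c\<close>. On such columns \<open>depar_step\<close>
  therefore only removes repetitions.\<close>

lemma unit_vec_eq_smult_iff: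
  assumes "q < m" "q' < m"
  shows "unit_vec m q = c \<cdot>\<^sub>v unit_vec m q' \<longleftrightarrow> c = (1 :: real) \<and> q = q'"
proof
  assume eq: "unit_vec m q = c \<cdot>\<^sub>v unit_vec m q'"
  have "unit_vec m q $ q = (c \<cdot>\<^sub>v unit_vec m q') $ q"
    unfolding eq ..
  then show "c = 1 \<and> q = q'"
    using assms by (auto split: if_splits)
qed simp

text \<open>\<open>ks\<close> holds the positions of the ones in the kept columns, and
  \<open>ts\<close> gives for each processed column the index of the kept column equal to it. The
  fold runs from the left, so the induction extends the list at its end.\<close>

lemma foldl_depar_step_unit_vec:
  assumes "\<And>q. q \<in> set qs \<Longrightarrow> q < m"
  shows "\<exists>ks ts. foldl depar_step ([], []) (map (unit_vec m) qs) =
      (map (unit_vec m) ks, map (\<lambda>t. (t, 1)) ts) \<and> distinct ks \<and> set ks \<subseteq> {..<m} \<and>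
      length ts = length qs \<and> (\<forall>j<length qs. ts ! j < length ks \<and> ks ! (ts ! j) = qs ! j)"
  using assms
proof (induction qs rule: rev_induct)
  case Nil
  show ?case
    by (intro exI[of _ "[]"]) simp
next
  case (snoc q qs)
  then obtain ks ts where fold: "foldl depar_step ([], []) (map (unit_vec m) qs) =
      (map (unit_vec m) ks, map (\<lambda>t. (t, 1)) ts)" and ks: "distinct ks" "set ks \<subseteq> {..<m}"
    and ts: "length ts = length qs" "\<And>j. j < length qs \<Longrightarrow> ts ! j < length ks \<and> ks ! (ts ! j) = qs ! j"
    by auto
  have q: "q < m"
    using snoc by simp
  have eq: "unit_vec m q = c \<cdot>\<^sub>v (map (unit_vec m) ks ! i) \<longleftrightarrow> c = (1::real) \<and> ks ! i = q"
    if "i < length ks" for i c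
  proof -
    have "ks ! i < m"
      using that ks(2) nth_mem by blast
    then show ?thesis
      using that q unit_vec_eq_smult_iff[of q m "ks ! i" c] by auto
  qed
  show ?case
  proof (cases "q \<in> set ks")
    case True
    then obtain i where i: "i < length ks" "ks ! i = q"
      by (auto simp: in_set_conv_nth)
    have uniq: "i' = i" if "i' < length ks" "ks ! i' = q" for i'
      using that i ks(1) nth_eq_iff_index_eq by metis
    \<comment> \<open>Kept vectors are distinct, so only index \<open>i\<close> qualifies and
      \<open>LEAST\<close> has nothing to choose; likewise \<open>SOME\<close> below returns the
      only possible factor 1.\<close>
    have L: "(LEAST i. i < length (map (unit_vec m) ks) \<and>
        (\<exists>c::real. unit_vec m q = c \<cdot>\<^sub>v (map (unit_vec m) ks ! i))) = i"
    proof (rule Least_equality)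
      show "i < length (map (unit_vec m) ks) \<and> (\<exists>c::real. unit_vec m q = c \<cdot>\<^sub>v (map (unit_vec m) ks ! i))"
        using i eq by auto
      show "i \<le> i'" if "i' < length (map (unit_vec m) ks) \<and>
          (\<exists>c::real. unit_vec m q = c \<cdot>\<^sub>v (map (unit_vec m) ks ! i'))" for i'
      proof -
        have "i' < length ks" "ks ! i' = q"
          using that eq[of i'] by (metis length_map)+
        then show ?thesis
          using uniq by simp
      qed
    qed
    have C: "(SOME c::real. unit_vec m q = c \<cdot>\<^sub>v (map (unit_vec m) ks ! i)) = 1"
      unfolding eq[OF i(1)] using i by simp
    have ex: "\<exists>i<length (map (unit_vec m) ks). \<exists>c::real. unit_vec m q = c \<cdot>\<^sub>v (map (unit_vec m) ks ! i)"
      using i eq by auto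
    have new: "foldl depar_step ([], []) (map (unit_vec m) (qs @ [q])) =
        (map (unit_vec m) ks, map (\<lambda>t. (t, 1)) (ts @ [i]))"
      unfolding map_append foldl_append fold
      by (simp only: list.map foldl_Cons foldl_Nil depar_step_def prod.case if_P[OF ex] Let_def L C map_append)
    show ?thesis
      by (rule exI[of _ ks], rule exI[of _ "ts @ [i]"], intro conjI, rule new)
        (use ks ts i in \<open>auto simp: nth_append less_Suc_eq\<close>)
  next
    case False
    have nex: "\<not> (\<exists>i<length (map (unit_vec m) ks). \<exists>c::real. unit_vec m q = c \<cdot>\<^sub>v (map (unit_vec m) ks ! i))"
      using False eq by (auto simp: in_set_conv_nth)
    have new: "foldl depar_step ([], []) (map (unit_vec m) (qs @ [q])) =
        (map (unit_vec m) (ks @ [q]), map (\<lambda>t. (t, 1)) (ts @ [length ks]))"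
      unfolding map_append foldl_append fold
      by (simp only: list.map foldl_Cons foldl_Nil depar_step_def prod.case if_not_P[OF nex]) simp
    show ?thesis
      by (rule exI[of _ "ks @ [q]"], rule exI[of _ "ts @ [length ks]"], intro conjI, rule new)
        (use ks ts q False in \<open>auto simp: nth_append less_Suc_eq\<close>)
  qed
qed

text \<open>The kept columns are distinct unit vectors, hence orthonormal, and each column of
  \<open>T\<close> selects one of them. The last claim is there because the next core is multiplied
  by \<open>T\<close>.\<close>

lemma depar_unit_cols:
  assumes "unit_cols {..<dim_row M} (dim_col M) (\<lambda>x c. M $$ (x, c))" "depar M = (N, T)"
  shows "mat_factor 0 M N T" (is ?fac)
    and "unit_cols {..<dim_row N} (dim_col N) (\<lambda>x c. N $$ (x, c))" (is ?N)
    and "unit_cols {..<dim_row T} (dim_col T) (\<lambda>x c. T $$ (x, c))" (is ?T)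
proof -
  define m n where "m = dim_row M" and "n = dim_col M"
  obtain \<rho> where \<rho>: "\<And>c. c < n \<Longrightarrow> \<rho> c < m" "\<And>c x. c < n \<Longrightarrow> x < m \<Longrightarrow> M $$ (x, c) = of_bool (x = \<rho> c)"
    using assms(1) by (auto simp: unit_cols_def m_def n_def)
  have cols: "cols M = map (unit_vec m) (map \<rho> [0..<n])"
    by (rule nth_equalityI) (auto simp: n_def[symmetric] m_def[symmetric] \<rho> intro!: eq_vecI)
  obtain ks ts where fold: "foldl depar_step ([], []) (cols M) =
      (map (unit_vec m) ks, map (\<lambda>t. (t, 1)) ts)"
    and ks: "distinct ks" "set ks \<subseteq> {..<m}" and ts: "length ts = n"
      "\<And>j. j < n \<Longrightarrow> ts ! j < length ks" "\<And>j. j < n \<Longrightarrow> ks ! (ts ! j) = \<rho> j"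
  proof -
    have len: "length (map \<rho> [0..<n]) = n" and nth: "\<And>j. j < n \<Longrightarrow> map \<rho> [0..<n] ! j = \<rho> j"
      by simp_all
    have "\<And>q. q \<in> set (map \<rho> [0..<n]) \<Longrightarrow> q < m"
      using \<rho>(1) by auto
    from foldl_depar_step_unit_vec[of "map \<rho> [0..<n]" m, OF this] obtain ks ts where *:
      "foldl depar_step ([], []) (map (unit_vec m) (map \<rho> [0..<n])) =
        (map (unit_vec m) ks, map (\<lambda>t. (t, 1)) ts)" "distinct ks" "set ks \<subseteq> {..<m}"
      "length ts = n" "\<forall>j<n. ts ! j < length ks \<and> ks ! (ts ! j) = map \<rho> [0..<n] ! j"
      unfolding len by blast
    then show ?thesis
      using that[of ks ts] nth by (simp add: cols)
  qed
  define k where "k = length ks"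
  have NT: "N = mat m k (\<lambda>(r, i). map (unit_vec m) ks ! i $ r)"
    "T = mat k n (\<lambda>(i, j). if fst (map (\<lambda>t. (t, 1 :: real)) ts ! j) = i then snd (map (\<lambda>t. (t, 1)) ts ! j) else 0)"
    using assms(2) unfolding depar_def fold by (auto simp: m_def n_def k_def)
  have dims: "dim_row N = m" "dim_col N = k" "dim_row T = k" "dim_col T = n"
    by (simp_all add: NT)
  have ksm: "ks ! c < m" if "c < k" for c
    using that ks(2) nth_mem[of c ks] unfolding k_def by blast
  have N: "N $$ (x, c) = of_bool (x = ks ! c)" if "x < m" "c < k" for x c
    using that ksm by (auto simp: NT k_def)
  have T: "T $$ (c, j) = of_bool (c = ts ! j)" if "c < k" "j < n" for c j
    using that ts(1) by (auto simp: NT)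
  show ?N
    unfolding unit_cols_def dims by (rule exI[of _ "\<lambda>c. ks ! c"]) (auto simp: N ksm)
  show ?T
    unfolding unit_cols_def dims by (rule exI[of _ "\<lambda>c. ts ! c"]) (auto simp: T ts k_def)
  show ?fac
  proof (rule mat_factor_exact)
    have "ks ! c = ks ! c' \<longleftrightarrow> c = c'" if "c < k" "c' < k" for c c'
      using that ks(1) by (simp add: nth_eq_iff_index_eq k_def)
    then show "orthonormal_cols {..<dim_row M} (dim_col N) (\<lambda>x c. N $$ (x, c))"
      unfolding orthonormal_cols_def dims m_def[symmetric]
      by (auto simp: N ksm sum_of_bool_right cong: sum.cong_simp)
    show "M $$ (x, l) = (\<Sum>c<dim_col N. N $$ (x, c) * T $$ (c, l))"
      if "x < dim_row M" "l < dim_col M" for x l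
      using that ts k_def by (simp add: N T dims m_def[symmetric] n_def[symmetric] \<rho> cong: sum.cong_simp)
  qed (simp_all add: dims m_def n_def)
qed

section \<open>The algorithms as sweeps\<close>

lemma svd1_left_step:
  assumes "tt_wf r ns Gs s" "\<forall>n\<in>set ns. 0 < n" "0 < k" "k < length Gs" "svd1_step \<delta> k Gs Gs'"
  shows "left_step \<delta> (k - 1) Gs Gs'"
proof -
  obtain j where k: "k = Suc j"
    using assms(3) by (cases k) auto
  have pos: "0 < cmid (Gs ! j)"
    using assms tt_wf_cmid[OF assms(1), of j] tt_wf_length[OF assms(1)] k by auto
  obtain U S V where svd: "is_trunc_svd \<delta> (Lunf (Gs ! j)) U S V"
    and Gs': "Gs' = Gs[j := of_Lunf (cmid (Gs ! j)) U,
      Suc j := map_slices (dim_row S) (ccol (Gs ! Suc j)) (\<lambda>X. S * transpose_mat V * X) (Gs ! Suc j)]"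
    using assms(5) unfolding svd1_step_def k by auto
  show ?thesis
    using left_step_Lunf[OF assms(1) _ pos mat_factor_svd(1)[OF svd]] assms(4) k Gs' by simp
qed

lemma qr_left_step:
  assumes "tt_wf r ns Gs s" "\<forall>n\<in>set ns. 0 < n" "1 < k" "k \<le> length Gs" "qr_step k Gs Gs'"
  shows "left_step 0 (length Gs - k) (tt_transpose Gs) (tt_transpose Gs')"
proof -
  obtain j where k: "k = Suc (Suc j)"
    using assms(3) that[of "k - 2"] by simp
  have pos: "0 < cmid (Gs ! Suc j)"
    using assms tt_wf_cmid[OF assms(1), of "Suc j"] tt_wf_length[OF assms(1)] k by auto
  obtain Q R where qr: "is_econ_qr (transpose_mat (Runf (Gs ! Suc j))) Q R"
    and Gs': "Gs' = Gs[Suc j := of_Runf (cmid (Gs ! Suc j)) (transpose_mat Q),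
      j := map_slices (crow (Gs ! j)) (dim_row R) (\<lambda>X. X * transpose_mat R) (Gs ! j)]"
    using assms(5) unfolding qr_step_def k by auto
  show ?thesis
    using left_step_Runf[OF assms(1) _ pos mat_factor_qr[OF qr]] assms(4) k Gs' by simp
qed

lemma svd2_left_step:
  assumes "tt_wf r ns Gs s" "\<forall>n\<in>set ns. 0 < n" "1 < k" "k \<le> length Gs" "svd2_step \<delta> k Gs Gs'"
  shows "left_step \<delta> (length Gs - k) (tt_transpose Gs) (tt_transpose Gs')"
proof -
  obtain j where k: "k = Suc (Suc j)"
    using assms(3) that[of "k - 2"] by simp
  have pos: "0 < cmid (Gs ! Suc j)"
    using assms tt_wf_cmid[OF assms(1), of "Suc j"] tt_wf_length[OF assms(1)] k by auto
  obtain U S V where svd: "is_trunc_svd \<delta> (transpose_mat (Runf (Gs ! Suc j))) U S V"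
    and Gs': "Gs' = Gs[Suc j := of_Runf (cmid (Gs ! Suc j)) (transpose_mat U),
      j := map_slices (crow (Gs ! j)) (dim_col S) (\<lambda>X. X * V * S) (Gs ! j)]"
    using assms(5) unfolding svd2_step_def k by auto
  note S = mat_factor_svd(2,3)[OF svd] and V = mat_factor_svd(4)[OF svd]
  have "ccol (Gs ! j) = crow (Gs ! Suc j)"
    using tt_wf_link[OF assms(1), of j] tt_wf_length[OF assms(1)] assms(4) k by simp
  then have "slice (Gs ! j) i \<in> carrier_mat (crow (Gs ! j)) (dim_row V)" for i
    using V by (simp add: slice_def Runf_def)
  \<comment> \<open>\<open>S\<close> is diagonal, hence symmetric, so \<open>V * S\<close> is the
    transpose of \<open>S * transpose_mat V\<close>, the remainder factor in the form that
    \<open>left_step_Runf\<close> expects.\<close>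
  then have "slice (Gs ! j) i * V * S = slice (Gs ! j) i * transpose_mat (S * transpose_mat V)" for i
    using S V by (subst transpose_mult[of _ "dim_col U" "dim_col U" _ "dim_row V"])
      (auto intro: assoc_mult_mat)
  then have "map_slices (crow (Gs ! j)) (dim_col S) (\<lambda>X. X * V * S) (Gs ! j) =
      map_slices (crow (Gs ! j)) (dim_row (S * transpose_mat V))
        (\<lambda>X. X * transpose_mat (S * transpose_mat V)) (Gs ! j)"
    using S by (simp add: map_slices_def)
  then show ?thesis
    using left_step_Runf[OF assms(1) _ pos mat_factor_svd(1)[OF svd]] assms(4) k Gs' by simp
qed

section \<open>Unit columns of cores during the conversion\<close>

definition unit_core :: "core \<Rightarrow> bool" where
  "unit_core G \<longleftrightarrow> unit_cols (core_rows G) (ccol G) (core_ent G)"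

lemma unit_core_Lunf:
  "unit_core G \<Longrightarrow> unit_cols {..<dim_row (Lunf G)} (dim_col (Lunf G)) (\<lambda>x c. Lunf G $$ (x, c))"
  unfolding unit_core_def
  by (rule unit_cols_reindex[of "\<lambda>x. (x div cmid G, x mod cmid G)" _ "core_rows G"])
    (auto simp: Lunf_def bij_betw_div_mod)

lemma unit_core_of_Lunf:
  assumes "unit_cols {..<dim_row N} (dim_col N) (\<lambda>x c. N $$ (x, c))" "dim_row N = a * n" "0 < n"
  shows "unit_core (of_Lunf n N)"
  unfolding unit_core_def
  by (rule unit_cols_reindex[of "\<lambda>x. fst x * n + snd x" _ "{..<dim_row N}"])
    (use assms bij_betw_mult_add in \<open>auto simp: of_Lunf_def\<close>)

lemma unit_core_Runf:
  "unit_core (core_transpose G) \<Longrightarrow> unit_cols {..<dim_row (transpose_mat (Runf G))}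
    (dim_col (transpose_mat (Runf G))) (\<lambda>x c. transpose_mat (Runf G) $$ (x, c))"
  unfolding unit_core_def
  by (rule unit_cols_reindex[of "\<lambda>x. (x mod ccol G, x div ccol G)" _ "core_rows (core_transpose G)"])
    (auto simp: Runf_def bij_betw_mod_div)

lemma unit_core_of_Runf:
  assumes "unit_cols {..<dim_row N} (dim_col N) (\<lambda>x c. N $$ (x, c))" "dim_row N = n * b" "0 < n"
  shows "unit_core (core_transpose (of_Runf n (transpose_mat N)))"
proof -
  have "unit_cols ({..<b} \<times> {..<n}) (dim_col N) (core_ent (core_transpose (of_Runf n (transpose_mat N))))"
    by (rule unit_cols_reindex[OF _ assms(1)[unfolded assms(2)], OF bij_betw_mult_add_swap])
      (use assms(2,3) in \<open>auto simp: of_Runf_def mult_add_less\<close>)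
  then show ?thesis
    using assms(2,3) by (simp add: unit_core_def of_Runf_def)
qed

text \<open>The one at row \<open>(x, i)\<close> of a column moves to row
  \<open>(\<tau> x, i)\<close>, where \<open>\<tau> x\<close> is the position of the one in column
  \<open>x\<close> of \<open>T\<close>.\<close>

lemma unit_core_mult:
  assumes "core_mult r T H H'" "unit_cols {..<r} (crow H) T" "unit_core H"
  shows "unit_core H'"
proof -
  obtain \<rho> where \<rho>: "\<And>b. b < ccol H \<Longrightarrow> \<rho> b \<in> core_rows H"
    "\<And>b x. b < ccol H \<Longrightarrow> x \<in> core_rows H \<Longrightarrow> core_ent H x b = of_bool (x = \<rho> b)"
    using assms(3) unfolding unit_core_def unit_cols_def by blast
  obtain \<tau> where \<tau>: "\<And>x. x < crow H \<Longrightarrow> \<tau> x < r"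
    "\<And>x c. x < crow H \<Longrightarrow> c < r \<Longrightarrow> T c x = of_bool (c = \<tau> x)"
    using assms(2) unfolding unit_cols_def by auto
  have H': "crow H' = r" "cmid H' = cmid H" "ccol H' = ccol H"
    using assms(1) by (simp_all add: core_mult_def)
  have ent: "cent H' c i b = of_bool (c = \<tau> (fst (\<rho> b)) \<and> i = snd (\<rho> b))"
    if "c < r" "i < cmid H" "b < ccol H" for c i b
  proof -
    have \<rho>b: "fst (\<rho> b) < crow H"
      using \<rho>(1)[OF that(3)] by (auto simp: mem_Times_iff)
    have "cent H' c i b = (\<Sum>x<crow H. T c x * cent H x i b)"
      using assms(1) that by (simp add: core_mult_def)
    also have "\<dots> = (\<Sum>x<crow H. (T c x * of_bool (i = snd (\<rho> b))) * of_bool (x = fst (\<rho> b)))"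
      using \<rho>(2)[OF that(3), of "(_, i)"] that(2) by (intro sum.cong) (auto simp: prod_eq_iff)
    also have "\<dots> = T c (fst (\<rho> b)) * of_bool (i = snd (\<rho> b))"
      using \<rho>b by (subst sum_of_bool_right) simp
    finally show ?thesis
      using \<tau>(2)[OF \<rho>b that(1)] by simp
  qed
  show ?thesis
    unfolding unit_core_def unit_cols_def H'
  proof (rule exI[of _ "\<lambda>b. (\<tau> (fst (\<rho> b)), snd (\<rho> b))"], intro allI impI)
    fix b assume b: "b < ccol H"
    have "fst (\<rho> b) < crow H" "snd (\<rho> b) < cmid H"
      using \<rho>(1)[OF b] by (auto simp: mem_Times_iff)
    then show "(\<tau> (fst (\<rho> b)), snd (\<rho> b)) \<in> {..<r} \<times> {..<cmid H} \<and>
      (\<forall>x\<in>{..<r} \<times> {..<cmid H}. core_ent H' x b = of_bool (x = (\<tau> (fst (\<rho> b)), snd (\<rho> b))))"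
      using \<tau>(1) b by (auto simp: ent)
  qed
qed

text \<open>The last claim is conditional because in the final step of the left pass the core that
  absorbs \<open>T\<close> is the p-th one, which holds fiber values and need not have unit
  columns.\<close>

lemma conv_left_step_left_step:
  assumes "tt_wf r ns Gs s" "\<forall>n\<in>set ns. 0 < n" "0 < k" "k < length Gs" "unit_core (Gs ! (k - 1))"
  defines "Gs' \<equiv> conv_left_step ns k Gs"
  shows "left_step 0 (k - 1) Gs Gs'" "unit_core (Gs' ! (k - 1))"
    "unit_core (Gs ! k) \<Longrightarrow> unit_core (Gs' ! k)"
proof -
  obtain j where k: "k = Suc j"
    using assms(3) by (cases k) auto
  have n: "cmid (Gs ! j) = ns ! j" and pos: "0 < ns ! j"
    using assms tt_wf_cmid[OF assms(1), of j] tt_wf_length[OF assms(1)] k by auto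
  obtain N T where NT: "depar (Lunf (Gs ! j)) = (N, T)"
    by fastforce
  note dep = depar_unit_cols[OF unit_core_Lunf NT]
  have unit: "unit_core (Gs ! j)"
    using assms(5) k by simp
  have Gs': "Gs' = Gs[j := of_Lunf (ns ! j) N,
      Suc j := map_slices (dim_row T) (ccol (Gs ! Suc j)) (\<lambda>X. T * X) (Gs ! Suc j)]"
    unfolding Gs'_def conv_left_step_def k using NT by simp
  show "left_step 0 (k - 1) Gs Gs'"
    using left_step_Lunf[OF assms(1) _ _ dep(1)[OF unit]] n pos assms(4) k Gs' by simp
  have "dim_row N = crow (Gs ! j) * ns ! j"
    using dep(1)[OF unit] n by (simp add: mat_factor_def Lunf_def)
  then show "unit_core (Gs' ! (k - 1))"
    using unit_core_of_Lunf[OF dep(2)[OF unit] \<open>dim_row N = _\<close> pos] assms(4) k Gs' by simp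
  have T: "dim_col T = crow (Gs ! Suc j)"
    using dep(1)[OF unit] tt_wf_link[OF assms(1), of j] tt_wf_length[OF assms(1)] assms(4) k
    by (simp add: mat_factor_def Lunf_def)
  show "unit_core (Gs ! k) \<Longrightarrow> unit_core (Gs' ! k)"
    using unit_core_mult[OF core_mult_map_slices[OF T]] dep(3)[OF unit] T assms(4) k Gs' by simp
qed

lemma conv_right_step_left_step:
  assumes "tt_wf r ns Gs s" "\<forall>n\<in>set ns. 0 < n" "1 < k" "k \<le> length Gs"
    and "unit_core (core_transpose (Gs ! (k - 1)))"
  defines "Gs' \<equiv> conv_right_step ns k Gs"
  shows "left_step 0 (length Gs - k) (tt_transpose Gs) (tt_transpose Gs')"
    "unit_core (core_transpose (Gs' ! (k - 1)))"
    "unit_core (core_transpose (Gs ! (k - 2))) \<Longrightarrow> unit_core (core_transpose (Gs' ! (k - 2)))"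
proof -
  obtain j where k: "k = Suc (Suc j)"
    using assms(3) that[of "k - 2"] by simp
  have n: "cmid (Gs ! Suc j) = ns ! Suc j" and pos: "0 < ns ! Suc j"
    using assms tt_wf_cmid[OF assms(1), of "Suc j"] tt_wf_length[OF assms(1)] k by auto
  obtain N T where NT: "depar (transpose_mat (Runf (Gs ! Suc j))) = (N, T)"
    by fastforce
  note dep = depar_unit_cols[OF unit_core_Runf NT]
  have unit: "unit_core (core_transpose (Gs ! Suc j))"
    using assms(5) k by simp
  have Gs': "Gs' = Gs[Suc j := of_Runf (ns ! Suc j) (transpose_mat N),
      j := map_slices (crow (Gs ! j)) (dim_row T) (\<lambda>X. X * transpose_mat T) (Gs ! j)]"
    unfolding Gs'_def conv_right_step_def k using NT by simp
  show "left_step 0 (length Gs - k) (tt_transpose Gs) (tt_transpose Gs')"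
    using left_step_Runf[OF assms(1) _ _ dep(1)[OF unit]] n pos assms(4) k Gs' by simp
  have "dim_row N = ns ! Suc j * ccol (Gs ! Suc j)"
    using dep(1)[OF unit] n by (simp add: mat_factor_def Runf_def)
  then show "unit_core (core_transpose (Gs' ! (k - 1)))"
    using unit_core_of_Runf[OF dep(2)[OF unit] \<open>dim_row N = _\<close> pos] assms(4) k Gs' by simp
  have T: "dim_col T = ccol (Gs ! j)"
    using dep(1)[OF unit] tt_wf_link[OF assms(1), of j] tt_wf_length[OF assms(1)] assms(4) k
    by (simp add: mat_factor_def Runf_def)
  show "unit_core (core_transpose (Gs ! (k - 2))) \<Longrightarrow> unit_core (core_transpose (Gs' ! (k - 2)))"
    using unit_core_mult[OF core_mult_transpose_map_slices[OF T]] dep(3)[OF unit] T assms(4) k Gs' by simp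
qed

section \<open>Transport of chains along positions and reversal\<close>

lemma chain_mapI:
  assumes "chain R ks x y" "P x"
    and "\<And>k x y. k \<in> set ks \<Longrightarrow> P x \<Longrightarrow> R k x y \<Longrightarrow> R' (f k) (F x) (F y) \<and> P y"
  shows "chain R' (map f ks) (F x) (F y) \<and> P y"
  using assms
proof (induction ks arbitrary: x)
  case (Cons k ks)
  then obtain z where z: "R k x z" "chain R ks z y"
    by auto
  then have "R' (f k) (F x) (F z)" "P z"
    using Cons.prems(2,3) by auto
  then show ?case
    using Cons.IH[OF z(2)] Cons.prems(3) by auto
qed simp

text \<open>Lets \<open>chain_mapI\<close> treat the deterministic conversion like the relational
  rounding steps.\<close>

lemma chain_foldl: "chain (\<lambda>k x y. y = f x k) ks x (foldl f x ks)"
  by (induction ks arbitrary: x) auto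

lemma map_minus_upt: "map (\<lambda>k. k - 1) [Suc a..<Suc b] = [a..<b]"
  by (rule nth_equalityI) (auto simp del: upt_Suc)

text \<open>The core of mode \<open>k\<close> sits at position \<open>d - k\<close> of the reversed
  train, so descending modes become ascending positions.\<close>

lemma map_minus_rev_upt:
  "a \<le> b \<Longrightarrow> b \<le> d \<Longrightarrow> map (\<lambda>k. d - k) (rev [Suc a..<Suc b]) = [d - b..<d - a]"
  by (rule nth_equalityI) (auto simp: rev_nth simp del: upt_Suc)

lemma tt_wf_tt_transpose_iff: "tt_wf s (rev ns) (tt_transpose Gs) r \<longleftrightarrow> tt_wf r ns Gs s"
  using tt_wf_tt_transpose[of r ns Gs s] tt_wf_tt_transpose[of s "rev ns" "tt_transpose Gs" r] by auto

lemma core_transpose_nth: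
  "j < length Gs \<Longrightarrow> core_transpose (Gs ! j) = tt_transpose Gs ! (length Gs - Suc j)"
  by (simp add: nth_tt_transpose)

lemma nth_eq_of_tt_transpose:
  assumes "length Bs = length Gs" "j < length Gs"
    and "tt_transpose Bs ! (length Gs - Suc j) = tt_transpose Gs ! (length Gs - Suc j)"
  shows "Bs ! j = Gs ! j"
  using assms core_transpose_nth[of j Gs] core_transpose_nth[of j Bs] core_transpose_transpose by metis

lemma tt_dist2_tt_transpose:
  assumes "tt_wf 1 ns Gs 1" "tt_wf 1 ns Bs 1"
  shows "tt_dist2 1 (rev ns) (tt_transpose Gs) (tt_transpose Bs) = tt_dist2 1 ns Gs Bs"
  unfolding tt_dist2_def sum_idxs_rev
  by (intro sum.cong refl) (use assms in \<open>auto simp: tt_mat_tt_transpose idxs_def\<close>)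

section \<open>Exactness of the sparse conversion\<close>

text \<open>The rank r_k of the initial train.\<close>

definition bond :: "nat list \<Rightarrow> nat list list \<Rightarrow> nat \<Rightarrow> nat" where
  "bond ns fs k = (if k = 0 \<or> k = length ns then 1 else length fs)"

lemma init_core_simps:
  assumes "k < length ns"
  shows "crow (init_core ns A p fs (Suc k)) = bond ns fs k"
    "ccol (init_core ns A p fs (Suc k)) = bond ns fs (Suc k)"
    "cmid (init_core ns A p fs (Suc k)) = ns ! k"
  using assms by (auto simp: init_core_def bond_def Let_def)

lemma tt_wf_init_cores:
  "k \<le> length ns \<Longrightarrow>
    tt_wf (bond ns fs k) (drop k ns) (map (init_core ns A p fs) [Suc k..<Suc (length ns)]) 1"
proof (induction k rule: inc_induct)
  case base
  then show ?case
    by (simp add: bond_def)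
next
  case (step k)
  then show ?case
    by (simp add: Cons_nth_drop_Suc[symmetric] upt_conv_Cons init_core_simps del: upt_Suc)
qed

text \<open>The initial train is a sum of rank-one tensors, one for each nonzero fiber; this is the
  factor of such a tensor in mode \<open>k\<close>, counted from 0.\<close>

definition fiber_factor :: "(nat list \<Rightarrow> real) \<Rightarrow> nat \<Rightarrow> nat list \<Rightarrow> nat \<Rightarrow> nat \<Rightarrow> real" where
  "fiber_factor A p js k i = (if Suc k = p then A (js[p - 1 := i]) else of_bool (i = js ! k))"

text \<open>The inner cores are diagonal in the rank index, so row \<open>j\<close> follows fiber
  \<open>j\<close> alone. The condition \<open>0 < k\<close> leaves out the first core, whose left
  rank is 1.\<close>

lemma tt_mat_init_cores:
  assumes "0 < k" "k \<le> length ns - 1" "length ns \<ge> 2" "length is = length ns" "j < length fs"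
  shows "tt_mat (map (init_core ns A p fs) [Suc k..<Suc (length ns)]) (drop k is) j 0 =
    (\<Prod>m=k..<length ns. fiber_factor A p (fs ! j) m (is ! m))"
  using assms(2,1)
proof (induction k rule: inc_induct)
  case base
  obtain e where e: "length ns = Suc e" "0 < e"
    using assms(3) by (cases "length ns") auto
  then have "drop e is = [is ! e]"
    using assms(4) by (subst Cons_nth_drop_Suc[symmetric]) auto
  moreover have "{e..<Suc e} = {e}"
    by auto
  ultimately show ?case
    using e by (simp add: init_core_def Let_def fiber_factor_def of_bool_def)
next
  case (step k)
  have k: "k < length ns" "Suc k < length ns" "k < length is"
    using step assms by auto
  have "tt_mat (map (init_core ns A p fs) [Suc k..<Suc (length ns)]) (drop k is) j 0 =
      (\<Sum>c<length fs. cent (init_core ns A p fs (Suc k)) j (is ! k) c *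
        tt_mat (map (init_core ns A p fs) [Suc (Suc k)..<Suc (length ns)]) (drop (Suc k) is) c 0)"
    using k by (simp add: Cons_nth_drop_Suc[symmetric] upt_conv_Cons init_core_simps bond_def del: upt_Suc)
  also have "\<dots> = (\<Sum>c<length fs. of_bool (j = c) * (fiber_factor A p (fs ! j) k (is ! k) *
        tt_mat (map (init_core ns A p fs) [Suc (Suc k)..<Suc (length ns)]) (drop (Suc k) is) j 0))"
    using k step.prems by (intro sum.cong) (auto simp: init_core_def Let_def fiber_factor_def of_bool_def)
  also have "\<dots> = fiber_factor A p (fs ! j) k (is ! k) *
        tt_mat (map (init_core ns A p fs) [Suc (Suc k)..<Suc (length ns)]) (drop (Suc k) is) j 0"
    using assms(5) by simp
  also have "\<dots> = fiber_factor A p (fs ! j) k (is ! k) *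
      (\<Prod>m=Suc k..<length ns. fiber_factor A p (fs ! j) m (is ! m))"
    using step by simp
  finally show ?case
    using k by (simp add: prod.atLeast_Suc_lessThan)
qed

text \<open>The first core is a row over all fibers, which supplies the sum over \<open>j\<close>;
  with at least two modes it is not also the last core.\<close>

lemma tt_mat_init:
  assumes "length ns \<ge> 2" "length is = length ns"
  shows "tt_mat (map (init_core ns A p fs) [1..<length ns + 1]) is 0 0 =
    (\<Sum>j<length fs. \<Prod>m<length ns. fiber_factor A p (fs ! j) m (is ! m))"
proof -
  have "ns \<noteq> []"
    using assms(1) by auto
  then have ccol: "ccol (init_core ns A p fs (Suc 0)) = length fs"
    using assms(1) init_core_simps(2)[of 0 ns A p fs] by (simp add: bond_def)
  have "is = is ! 0 # drop 1 is"
    using assms by (cases "is") auto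
  moreover have "[1..<length ns + 1] = Suc 0 # [Suc 1..<Suc (length ns)]"
    by (subst upt_conv_Cons) (use assms in \<open>auto simp del: upt_Suc\<close>)
  ultimately have "tt_mat (map (init_core ns A p fs) [1..<length ns + 1]) is 0 0 =
      tt_mat (init_core ns A p fs (Suc 0) # map (init_core ns A p fs) [Suc 1..<Suc (length ns)])
        (is ! 0 # drop 1 is) 0 0"
    by (metis list.map(2))
  also have "\<dots> =
      (\<Sum>j<length fs. cent (init_core ns A p fs (Suc 0)) 0 (is ! 0) j *
        tt_mat (map (init_core ns A p fs) [Suc 1..<Suc (length ns)]) (drop 1 is) j 0)"
    by (simp add: ccol del: upt_Suc)
  also have "\<dots> = (\<Sum>j<length fs. fiber_factor A p (fs ! j) 0 (is ! 0) *
      (\<Prod>m=1..<length ns. fiber_factor A p (fs ! j) m (is ! m)))"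
  proof (intro sum.cong refl arg_cong2[where f = "(*)"])
    fix j assume "j \<in> {..<length fs}"
    then show "tt_mat (map (init_core ns A p fs) [Suc 1..<Suc (length ns)]) (drop 1 is) j 0 =
       (\<Prod>m=1..<length ns. fiber_factor A p (fs ! j) m (is ! m))"
      using assms by (intro tt_mat_init_cores) auto
  qed (auto simp: init_core_def Let_def fiber_factor_def of_bool_def)
  also have "\<dots> = (\<Sum>j<length fs. \<Prod>m<length ns. fiber_factor A p (fs ! j) m (is ! m))"
    using \<open>ns \<noteq> []\<close> by (simp add: lessThan_atLeast0 prod.atLeast_Suc_lessThan[of 0])
  finally show ?thesis .
qed

text \<open>Outside mode \<open>p\<close> the factors are indicators that vanish unless
  \<open>js\<close> agrees with \<open>is\<close>; in mode \<open>p\<close> both sides of the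
  comparison carry the placeholder 0.\<close>

lemma prod_fiber_factor:
  assumes "1 \<le> p" "p \<le> d" "length js = d" "length is = d" "js ! (p - 1) = 0"
  shows "(\<Prod>m<d. fiber_factor A p js m (is ! m)) = (if js = is[p - 1 := 0] then A is else 0)"
proof (cases "js = is[p - 1 := 0]")
  case True
  have "(\<Prod>m<d. fiber_factor A p js m (is ! m)) =
      fiber_factor A p js (p - 1) (is ! (p - 1)) * (\<Prod>m\<in>{..<d} - {p - 1}. fiber_factor A p js m (is ! m))"
    using assms(1,2) by (intro prod.remove) auto
  also have "(\<Prod>m\<in>{..<d} - {p - 1}. fiber_factor A p js m (is ! m)) = 1"
    using assms True by (intro prod.neutral) (auto simp: fiber_factor_def)
  also have "fiber_factor A p js (p - 1) (is ! (p - 1)) = A is"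
    using assms(1) True by (simp add: fiber_factor_def)
  finally show ?thesis
    using True by simp
next
  case False
  then obtain m where "m < d" "js ! m \<noteq> is[p - 1 := 0] ! m"
    using assms(3,4) by (metis length_list_update nth_equalityI)
  then have "m < d" "fiber_factor A p js m (is ! m) = 0"
    using assms by (auto simp: fiber_factor_def nth_list_update split: if_splits)
  then show ?thesis
    using False by (auto intro!: prod_zero)
qed

text \<open>Distinctness of \<open>fs\<close> leaves at most one matching fiber; if none matches,
  the fiber through \<open>is\<close> is zero and so is \<open>A is\<close>.\<close>

lemma tt_mat_init_eq:
  assumes "length ns \<ge> 2" "1 \<le> p" "p \<le> length ns" "distinct fs" "set fs = nonzero_fibers ns A p"
    and "is \<in> idxs ns"
  shows "tt_mat (map (init_core ns A p fs) [1..<length ns + 1]) is 0 0 = A is"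
proof -
  have len: "length is = length ns" and lt: "\<And>k. k < length ns \<Longrightarrow> is ! k < ns ! k"
    using assms(6) by (auto simp: idxs_def)
  have fs: "length (fs ! j) = length ns" "fs ! j ! (p - 1) = 0" if "j < length fs" for j
    using nth_mem[OF that] unfolding assms(5) by (auto simp: nonzero_fibers_def)
  have "tt_mat (map (init_core ns A p fs) [1..<length ns + 1]) is 0 0 =
      (\<Sum>j<length fs. if fs ! j = is[p - 1 := 0] then A is else 0)"
    unfolding tt_mat_init[OF assms(1) len]
    using assms(2,3) fs len by (intro sum.cong) (auto simp: prod_fiber_factor)
  also have "\<dots> = (\<Sum>js\<in>set fs. if js = is[p - 1 := 0] then A is else 0)"
    by (rule sum.reindex_bij_betw[OF bij_betw_nth]) (use assms(4) in auto)
  also have "\<dots> = (if is[p - 1 := 0] \<in> set fs then A is else 0)"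
    by simp
  also have "\<dots> = A is"
  proof -
    have "is[p - 1 := 0] \<in> set fs" if "A is \<noteq> 0"
      unfolding assms(5) nonzero_fibers_def using that len lt assms(2,3)
      by (auto intro!: exI[of _ "is ! (p - 1)"])
    then show ?thesis
      by auto
  qed
  finally show ?thesis .
qed

section \<open>Orthonormality in the converted train\<close>

lemma unit_core_init_left:
  assumes "Suc j < p" "p \<le> length ns" "set fs = nonzero_fibers ns A p"
  shows "unit_core (init_core ns A p fs (Suc j))"
proof -
  have "fs ! b ! j < ns ! j" if "b < length fs" for b
    using nth_mem[OF that] assms unfolding assms(3) by (auto simp: nonzero_fibers_def)
  \<comment> \<open>Column \<open>b\<close> has its one at the mode index of fiber \<open>b\<close>;
    the rank index is 0 in the first core, whose left rank is 1, and \<open>b\<close> in the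
    diagonal cores.\<close>
  then show ?thesis
    unfolding unit_core_def unit_cols_def
    by (intro exI[of _ "\<lambda>b. (if j = 0 then 0 else b, fs ! b ! j)"])
      (use assms(1,2) in \<open>auto simp: init_core_def Let_def\<close>)
qed

lemma unit_core_init_right:
  assumes "p \<le> j" "1 \<le> p" "j < length ns" "set fs = nonzero_fibers ns A p"
  shows "unit_core (core_transpose (init_core ns A p fs (Suc j)))"
proof -
  have "fs ! b ! j < ns ! j" if "b < length fs" for b
    using nth_mem[OF that] assms unfolding assms(4) by (auto simp: nonzero_fibers_def)
  then show ?thesis
    unfolding unit_core_def unit_cols_def
  proof (cases "Suc j = length ns")
    case True
    with \<open>\<And>b. b < length fs \<Longrightarrow> fs ! b ! j < ns ! j\<close> assms(1,2)
    show "\<exists>\<rho>. \<forall>c<ccol (core_transpose (init_core ns A p fs (Suc j))).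
        \<rho> c \<in> core_rows (core_transpose (init_core ns A p fs (Suc j))) \<and>
        (\<forall>x\<in>core_rows (core_transpose (init_core ns A p fs (Suc j))).
          core_ent (core_transpose (init_core ns A p fs (Suc j))) x c = of_bool (x = \<rho> c))"
      by (intro exI[of _ "\<lambda>b. (0, fs ! b ! j)"]) (auto simp: init_core_def Let_def True[symmetric])
  next
    case False
    with \<open>\<And>b. b < length fs \<Longrightarrow> fs ! b ! j < ns ! j\<close> assms(1,2,3)
    show "\<exists>\<rho>. \<forall>c<ccol (core_transpose (init_core ns A p fs (Suc j))).
        \<rho> c \<in> core_rows (core_transpose (init_core ns A p fs (Suc j))) \<and>
        (\<forall>x\<in>core_rows (core_transpose (init_core ns A p fs (Suc j))).
          core_ent (core_transpose (init_core ns A p fs (Suc j))) x c = of_bool (x = \<rho> c))"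
      by (intro exI[of _ "\<lambda>b. (b, fs ! b ! j)"]) (auto simp: init_core_def Let_def)
  qed
qed

text \<open>The left pass touches only the first p cores and the right pass only those from the p-th
  on, so neither spoils what the other one needs or has produced.\<close>

lemma sparse_tt_properties:
  assumes "length ns \<ge> 2" "1 \<le> p" "p \<le> length ns" "distinct fs" "set fs = nonzero_fibers ns A p"
    and pos: "\<forall>n\<in>set ns. 0 < n"
  defines "Gs \<equiv> sparse_tt ns A p fs"
  shows "tt_wf 1 ns Gs 1" and "\<And>is. is \<in> idxs ns \<Longrightarrow> tt_mat Gs is 0 0 = A is"
    and "\<And>j. Suc j < p \<Longrightarrow> left_orth (Gs ! j)"
    and "\<And>j. p \<le> j \<Longrightarrow> j < length ns \<Longrightarrow> left_orth (core_transpose (Gs ! j))"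
proof -
  define d where "d = length ns"
  define G0 where "G0 = map (init_core ns A p fs) [1..<d + 1]"
  \<comment> \<open>The range \<open>[1..<p]\<close> is written with \<open>Suc\<close> to fit
    \<open>map_minus_upt\<close>, which shifts mode numbers to list positions.\<close>
  define G1 where "G1 = foldl (\<lambda>Gs k. conv_left_step ns k Gs) G0 [Suc 0..<Suc (p - 1)]"
  have Gs: "Gs = foldl (\<lambda>Gs k. conv_right_step ns k Gs) G1 (rev [Suc p..<Suc d])"
    using assms(2) by (simp add: Gs_def sparse_tt_def Let_def d_def G0_def G1_def del: upt_Suc)
  have wf0: "tt_wf 1 ns G0 1"
    using tt_wf_init_cores[of 0 ns fs A p] by (simp add: G0_def bond_def d_def del: upt_Suc)
  have G0_nth: "G0 ! j = init_core ns A p fs (Suc j)" if "j < d" for j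
    using that by (simp add: G0_def del: upt_Suc)
  have G1: "chain (left_step 0) (map (\<lambda>k. k - 1) [Suc 0..<Suc (p - 1)]) G0 G1 \<and>
      (tt_wf 1 ns G1 1 \<and> (\<forall>j. Suc j < p \<longrightarrow> unit_core (G1 ! j)))"
    unfolding G1_def
  proof (rule chain_mapI[where F = "\<lambda>x. x" and P = "\<lambda>Gs. tt_wf 1 ns Gs 1 \<and> (\<forall>j. Suc j < p \<longrightarrow> unit_core (Gs ! j))",
        OF chain_foldl])
    show "tt_wf 1 ns G0 1 \<and> (\<forall>j. Suc j < p \<longrightarrow> unit_core (G0 ! j))"
      using wf0 G0_nth unit_core_init_left assms(3,5) by (simp add: d_def)
    fix k x y
    assume k: "k \<in> set [Suc 0..<Suc (p - 1)]" and y: "y = conv_left_step ns k x"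
      and P: "tt_wf 1 ns x 1 \<and> (\<forall>j. Suc j < p \<longrightarrow> unit_core (x ! j))"
    have k': "0 < k" "k < length x" "k < p" "unit_core (x ! (k - 1))"
      using k P assms(2,3) tt_wf_length[of 1 ns x 1] by auto
    note step = conv_left_step_left_step[OF conjunct1[OF P] pos k'(1,2,4), folded y]
    have "unit_core (y ! j)" if j: "Suc j < p" for j
    proof (cases "j = k - 1 \<or> j = k")
      case False
      then show ?thesis
        using left_step_unchanged[OF step(1), of j] k'(1) P j by simp
    qed (use step(2,3) P j in auto)
    then show "left_step 0 (k - 1) x y \<and> tt_wf 1 ns y 1 \<and> (\<forall>j. Suc j < p \<longrightarrow> unit_core (y ! j))"
      using step(1) left_step_wf[OF step(1)] P by simp
  qed
  then have ch1: "chain (left_step 0) [0..<p - 1] G0 G1" and wf1: "tt_wf 1 ns G1 1"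
    by (simp_all only: map_minus_upt)
  have len1: "length G1 = d"
    using tt_wf_length[OF wf1] by (simp add: d_def)
  have unit1: "unit_core (core_transpose (G1 ! j))" if "p \<le> j" "j < d" for j
    using sweep_unchanged[OF ch1, of j] unit_core_init_right[of p j ns fs A] assms(2,5) that G0_nth[OF that(2)]
    by (simp add: d_def)
  have G2: "chain (left_step 0) (map (\<lambda>k. d - k) (rev [Suc p..<Suc d])) (tt_transpose G1) (tt_transpose Gs) \<and>
      (tt_wf 1 ns Gs 1 \<and> (\<forall>j. p \<le> j \<longrightarrow> j < d \<longrightarrow> unit_core (core_transpose (Gs ! j))))"
    unfolding Gs
  proof (rule chain_mapI[where F = tt_transpose and P = "\<lambda>Gs. tt_wf 1 ns Gs 1 \<and>
        (\<forall>j. p \<le> j \<longrightarrow> j < d \<longrightarrow> unit_core (core_transpose (Gs ! j)))", OF chain_foldl])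
    show "tt_wf 1 ns G1 1 \<and> (\<forall>j. p \<le> j \<longrightarrow> j < d \<longrightarrow> unit_core (core_transpose (G1 ! j)))"
      using wf1 unit1 by simp
    fix k x y
    assume k: "k \<in> set (rev [Suc p..<Suc d])" and y: "y = conv_right_step ns k x"
      and P: "tt_wf 1 ns x 1 \<and> (\<forall>j. p \<le> j \<longrightarrow> j < d \<longrightarrow> unit_core (core_transpose (x ! j)))"
    have len: "length x = d"
      using P tt_wf_length[of 1 ns x 1] by (simp add: d_def)
    have k': "1 < k" "k \<le> length x" "unit_core (core_transpose (x ! (k - 1)))"
      using k P assms(2) len by auto
    note step = conv_right_step_left_step[OF conjunct1[OF P] pos k', folded y, unfolded len]
    have wfy: "tt_wf 1 ns y 1"
      using left_step_wf[OF step(1)] P tt_wf_tt_transpose_iff by blast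
    have "unit_core (core_transpose (y ! j))" if j: "p \<le> j" "j < d" for j
    proof (cases "j = k - 1 \<or> j = k - 2")
      case False
      \<comment> \<open>Modes \<open>k\<close> and \<open>k - 1\<close> occupy position
        \<open>d - k\<close> and its successor in the reversed train; list position \<open>j\<close>
        corresponds to neither.\<close>
      then have "d - Suc j \<noteq> d - k" "d - Suc j \<noteq> Suc (d - k)"
        using j k'(1,2) len by auto
      from left_step_unchanged[OF step(1) this] have "y ! j = x ! j"
        using nth_eq_of_tt_transpose[of y x j] j len tt_wf_length[OF wfy] by (simp add: d_def)
      then show ?thesis
        using P j by simp
    qed (use step(2,3) P j in auto)
    then show "left_step 0 (d - k) (tt_transpose x) (tt_transpose y) \<and> tt_wf 1 ns y 1 \<and>
        (\<forall>j. p \<le> j \<longrightarrow> j < d \<longrightarrow> unit_core (core_transpose (y ! j)))"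
      using step(1) wfy by simp
  qed
  moreover have "map (\<lambda>k. d - k) (rev [Suc p..<Suc d]) = [0..<d - p]"
    using map_minus_rev_upt[of p d d] assms(3) by (simp add: d_def)
  ultimately have ch2: "chain (left_step 0) [0..<d - p] (tt_transpose G1) (tt_transpose Gs)"
    and wf2: "tt_wf 1 ns Gs 1"
    by simp_all
  have len2: "length Gs = d"
    using tt_wf_length[OF wf2] by (simp add: d_def)
  show "tt_wf 1 ns Gs 1"
    by (rule wf2)
  show "tt_mat Gs is 0 0 = A is" if "is \<in> idxs ns" for "is"
  proof -
    have len: "length is = length ns"
      using that by (simp add: idxs_def)
    have "tt_mat Gs is 0 0 = tt_mat (tt_transpose Gs) (rev is) 0 0"
      using tt_mat_tt_transpose[OF wf2 len, of 0 0] by simp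
    also have "\<dots> = tt_mat (tt_transpose G1) (rev is) 0 0"
      by (rule chain_left_step_exact[OF ch2 tt_wf_tt_transpose[OF wf1] rev_in_idxs_rev[OF that]]) simp
    also have "\<dots> = tt_mat G1 is 0 0"
      using tt_mat_tt_transpose[OF wf1 len, of 0 0] by simp
    also have "\<dots> = tt_mat G0 is 0 0"
      by (rule chain_left_step_exact[OF ch1 wf0 that]) simp
    also have "\<dots> = A is"
      unfolding G0_def d_def using assms(1-5) that by (rule tt_mat_init_eq)
    finally show ?thesis .
  qed
  show "left_orth (Gs ! j)" if "Suc j < p" for j
  proof -
    have "tt_transpose Gs ! (d - Suc j) = tt_transpose G1 ! (d - Suc j)"
      by (rule sweep_unchanged[OF ch2]) (use that assms(3) in \<open>auto simp: d_def\<close>)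
    then have "Gs ! j = G1 ! j"
      using nth_eq_of_tt_transpose[of Gs G1 j] that assms(3) len1 len2 by (simp add: d_def)
    then show ?thesis
      using sweep_left_orth[OF ch1, of j] that by simp
  qed
  show "left_orth (core_transpose (Gs ! j))" if "p \<le> j" "j < length ns" for j
    using sweep_left_orth[OF ch2, of "d - Suc j"] that len2 core_transpose_nth[of j Gs] by (simp add: d_def)
qed

section \<open>The two sweeps combined\<close>

theorem theorem3:
  fixes ns :: "nat list" and A :: "nat list \<Rightarrow> real" and p :: nat and \<epsilon> :: real
    and fs :: "nat list list" and Bs :: "core list"
  assumes "length ns \<ge> 2"
    and "1 \<le> p" and "p \<le> length ns"
    and "\<epsilon> \<ge> 0"
    and "distinct fs" and "set fs = nonzero_fibers ns A p"
    and "tt_round \<epsilon> p (fro_norm ns A) (sparse_tt ns A p fs) Bs"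
  shows "fro_norm ns (\<lambda>is. A is - tt_entry Bs is) \<le> \<epsilon> * fro_norm ns A"
proof (cases "\<forall>n\<in>set ns. 0 < n")
  \<comment> \<open>Modes of size 0 are split off because reshaping divides by the mode size; here
    the index set is empty and both norms are 0.\<close>
  case False
  then have "0 \<in> set ns"
    by auto
  then obtain k where k: "k < length ns" "ns ! k = 0"
    unfolding in_set_conv_nth by blast
  have "is \<notin> idxs ns" for "is"
  proof
    assume "is \<in> idxs ns"
    then have "is ! k < ns ! k"
      using k(1) by (simp add: idxs_def)
    then show False
      using k(2) by simp
  qed
  then have "idxs ns = {}"
    by blast
  then show ?thesis
    by (simp add: fro_norm_def)
next
  case pos: True
  define d where "d = length ns"
  define Gs where "Gs = sparse_tt ns A p fs"
  define \<delta> where "\<delta> = \<epsilon> / (sqrt (real (p - 1)) + sqrt (real (d - p))) * fro_norm ns A"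
  note sparse = sparse_tt_properties[OF assms(1-3,5,6) pos, folded Gs_def d_def]
  have lenG: "length Gs = d"
    using tt_wf_length[OF sparse(1)] by (simp add: d_def)
  obtain G1 G2 where chains: "chain (svd1_step \<delta>) [p..<d] Gs G1"
    "chain qr_step (rev [p+1..<d+1]) G1 G2" "chain (svd2_step \<delta>) (rev [2..<p+1]) G2 Bs"
    using assms(7) unfolding tt_round_def Let_def Gs_def[symmetric] lenG \<delta>_def[symmetric] by blast
  have "chain (left_step \<delta>) (map (\<lambda>k. k - 1) [p..<d]) Gs G1 \<and> tt_wf 1 ns G1 1"
  proof (rule chain_mapI[where F = "\<lambda>x. x" and P = "\<lambda>x. tt_wf 1 ns x 1", OF chains(1) sparse(1)])
    fix k x y assume k: "k \<in> set [p..<d]" and wf: "tt_wf 1 ns x 1" and step: "svd1_step \<delta> k x y"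
    have "left_step \<delta> (k - 1) x y"
      using svd1_left_step[OF wf pos _ _ step] k assms(2) tt_wf_length[OF wf] by (auto simp: d_def)
    then show "left_step \<delta> (k - 1) x y \<and> tt_wf 1 ns y 1"
      using left_step_wf wf by blast
  qed
  \<comment> \<open>Modes p to d - 1 are the \<open>d - p\<close> positions from
    \<open>p - 1\<close> on; this count enters the error bound.\<close>
  moreover have "Suc (p - 1) = p" "Suc (d - 1) = d" "d - 1 = p - 1 + (d - p)"
    using assms(1-3) by (auto simp: d_def)
  then have "map (\<lambda>k. k - 1) [p..<d] = [p - 1..<p - 1 + (d - p)]"
    using map_minus_upt[of "p - 1" "d - 1"] by metis
  ultimately have ch1: "chain (left_step \<delta>) [p - 1..<p - 1 + (d - p)] Gs G1" and wf1: "tt_wf 1 ns G1 1"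
    by simp_all
  have "chain (left_step 0) (map (\<lambda>k. d - k) (rev [p+1..<d+1])) (tt_transpose G1) (tt_transpose G2) \<and>
      tt_wf 1 ns G2 1"
  proof (rule chain_mapI[where P = "\<lambda>x. tt_wf 1 ns x 1", OF chains(2) wf1])
    fix k x y assume k: "k \<in> set (rev [p+1..<d+1])" and wf: "tt_wf 1 ns x 1" and step: "qr_step k x y"
    have "left_step 0 (d - k) (tt_transpose x) (tt_transpose y)"
      using qr_left_step[OF wf pos _ _ step] k assms(2) tt_wf_length[OF wf] by (auto simp: d_def)
    then show "left_step 0 (d - k) (tt_transpose x) (tt_transpose y) \<and> tt_wf 1 ns y 1"
      using left_step_wf wf tt_wf_tt_transpose_iff by blast
  qed
  moreover have "map (\<lambda>k. d - k) (rev [p+1..<d+1]) = [0..<d - p]"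
    using map_minus_rev_upt[of p d d] assms(3) by (simp add: d_def del: upt_Suc)
  ultimately have ch2: "chain (left_step 0) [0..<d - p] (tt_transpose G1) (tt_transpose G2)"
    and wf2: "tt_wf 1 ns G2 1"
    by simp_all
  have "chain (left_step \<delta>) (map (\<lambda>k. d - k) (rev [2..<p+1])) (tt_transpose G2) (tt_transpose Bs) \<and>
      tt_wf 1 ns Bs 1"
  proof (rule chain_mapI[where P = "\<lambda>x. tt_wf 1 ns x 1", OF chains(3) wf2])
    fix k x y assume k: "k \<in> set (rev [2..<p+1])" and wf: "tt_wf 1 ns x 1" and step: "svd2_step \<delta> k x y"
    have "left_step \<delta> (d - k) (tt_transpose x) (tt_transpose y)"
      using svd2_left_step[OF wf pos _ _ step] k assms(3) tt_wf_length[OF wf] by (auto simp: d_def)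
    then show "left_step \<delta> (d - k) (tt_transpose x) (tt_transpose y) \<and> tt_wf 1 ns y 1"
      using left_step_wf wf tt_wf_tt_transpose_iff by blast
  qed
  \<comment> \<open>In the reversed train the p-th core is at position \<open>d - p\<close>, and the
    second sweep makes \<open>p - 1\<close> truncations from there.\<close>
  moreover have "map (\<lambda>k. d - k) (rev [2..<p+1]) = [d - p..<d - p + (p - 1)]"
    using map_minus_rev_upt[of 1 p d] assms(2,3) by (simp add: d_def numeral_2_eq_2 del: upt_Suc)
  ultimately have ch3: "chain (left_step \<delta>) [d - p..<d - p + (p - 1)] (tt_transpose G2) (tt_transpose Bs)"
    and wf3: "tt_wf 1 ns Bs 1"
    by simp_all
  have len: "length G1 = d" "length G2 = d" "length Bs = d"
    using tt_wf_length wf1 wf2 wf3 by (auto simp: d_def)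
  have err1: "tt_dist2 1 ns Gs G1 \<le> real (d - p) * \<delta>\<^sup>2"
    by (rule sweep_bound[OF ch1 sparse(1)]) (use assms(1-3) lenG sparse(3,4) in \<open>auto simp: d_def\<close>)
  \<comment> \<open>Positions before \<open>p - 1\<close> lie outside the first sweep and the QR
    sweep, so they keep the orthonormality given by the conversion.\<close>
  have G1_left: "left_orth (G1 ! j)" if "Suc j < p" for j
    using sweep_unchanged[OF ch1, of j] sparse(3)[of j] that by (simp add: less_diff_conv)
  have G2_left: "left_orth (G2 ! j)" if "Suc j < p" for j
  proof -
    have "tt_transpose G2 ! (d - Suc j) = tt_transpose G1 ! (d - Suc j)"
      by (rule sweep_unchanged[OF ch2]) (use that assms(3) in \<open>auto simp: d_def\<close>)
    then have "G2 ! j = G1 ! j"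
      using nth_eq_of_tt_transpose[of G2 G1 j] that assms(3) len by (simp add: d_def)
    then show ?thesis
      using G1_left[OF that] by simp
  qed
  have "tt_dist2 1 (rev ns) (tt_transpose G2) (tt_transpose Bs) \<le> real (p - 1) * \<delta>\<^sup>2"
  proof (rule sweep_bound[OF ch3 tt_wf_tt_transpose[OF wf2]])
    \<comment> \<open>This side is supplied by the QR sweep, the other side by the cores that
      neither earlier sweep has touched.\<close>
    show "left_orth (tt_transpose G2 ! k)" if "k < d - p" for k
      using sweep_left_orth[OF ch2, of k] that by simp
    show "left_orth (core_transpose (tt_transpose G2 ! k))" if "d - p < k" "k < length (tt_transpose G2)" for k
      using that len G2_left[of "d - Suc k"] by (simp add: nth_tt_transpose)
  qed (use assms(1-3) len in \<open>auto simp: d_def\<close>)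
  then have err2: "tt_dist2 1 ns G2 Bs \<le> real (p - 1) * \<delta>\<^sup>2"
    using tt_dist2_tt_transpose[OF wf2 wf3] by simp
  have G12: "tt_mat G1 is 0 0 = tt_mat G2 is 0 0" if "is \<in> idxs ns" for "is"
  proof -
    have "length is = length ns"
      using that by (simp add: idxs_def)
    then show ?thesis
      using chain_left_step_exact[OF ch2 tt_wf_tt_transpose[OF wf1] rev_in_idxs_rev[OF that], of 0 0]
        tt_mat_tt_transpose[OF wf1, of "is" 0 0] tt_mat_tt_transpose[OF wf2, of "is" 0 0] by simp
  qed
  \<comment> \<open>\<open>G1\<close> and \<open>G2\<close> represent the same tensor and cancel, so
    the two brackets are the errors of the two SVD sweeps.\<close>
  have "fro_norm ns (\<lambda>is. A is - tt_entry Bs is) =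
      L2_set (\<lambda>is. (tt_mat Gs is 0 0 - tt_mat G1 is 0 0) + (tt_mat G2 is 0 0 - tt_mat Bs is 0 0)) (idxs ns)"
    unfolding fro_norm_def L2_set_def
    by (intro arg_cong[of _ _ sqrt] sum.cong refl)
      (use tt_entry_eq_tt_mat[OF wf3] sparse(2) G12 in \<open>auto simp: idxs_def\<close>)
  also have "\<dots> \<le> sqrt (tt_dist2 1 ns Gs G1) + sqrt (tt_dist2 1 ns G2 Bs)"
    using L2_set_triangle_ineq[of "\<lambda>is. tt_mat Gs is 0 0 - tt_mat G1 is 0 0"
        "\<lambda>is. tt_mat G2 is 0 0 - tt_mat Bs is 0 0" "idxs ns"]
    by (simp add: L2_set_def tt_dist2_def)
  also have "\<dots> \<le> sqrt (real (d - p) * \<delta>\<^sup>2) + sqrt (real (p - 1) * \<delta>\<^sup>2)"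
    using err1 err2 by (intro add_mono real_sqrt_le_mono)
  also have "\<dots> = (sqrt (real (p - 1)) + sqrt (real (d - p))) * \<delta>"
  proof -
    have "0 \<le> \<delta>"
      unfolding \<delta>_def using assms(4) by (intro mult_nonneg_nonneg divide_nonneg_nonneg) (auto simp: fro_norm_def sum_nonneg)
    then show ?thesis
      by (simp add: real_sqrt_mult algebra_simps)
  qed
  also have "\<dots> = \<epsilon> * fro_norm ns A"
  proof -
    \<comment> \<open>With at least two modes one of the sweeps is nonempty, so the denominator in
      \<open>\<delta>\<close> is positive.\<close>
    have "0 < real (p - 1) \<or> 0 < real (d - p)"
      using assms(1-3) by (auto simp: d_def)
    then have "0 < sqrt (real (p - 1)) + sqrt (real (d - p))"
      by (auto intro: add_pos_nonneg add_nonneg_pos)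
    then show ?thesis
      by (simp add: \<delta>_def)
  qed
  finally show ?thesis .
qed

end
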